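(* Let $G$ be a left-reflection bigraph and let $c$ be its natural coloring. Then the colored bigraph $(G,c)$ is right-uniform, color-edge-transitive and left-weakly Hölder.
   Context: A bigraph is a triple $G=(V_1,V_2,E)$ with $V_1,V_2$ disjoint finite sets and $E\subseteq V_1\times V_2$; write $V_i(G)=V_i$, $v_i(G)=|V_i|$, $E(G)=E$, $V(G)=V_1\cup V_2$. Reflection groups. Let $R\subseteq \mathrm{GL}_n(\mathbb{R})$ be a finite group generated by (orthogonal) reflections and let $T\subseteq R$ be the set of reflections in $R$. The root system $\Phi$ is the set of unit vectors orthogonal to some hyperplane fixed by an element of $T$. Given an ordered basis $(u_1,\ldots,u_n)$ of $\mathbb{R}^n$, a root $\alpha=\sum_i c_iu_i$ is positive if $c_{i_0}>0$ for the first index $i_0$ with $c_{i_0}\neq 0$; $\Phi^+$ is the set of positive roots. The simple system $\Delta\subseteq\Phi^+$ is the (unique) minimal subset of $\Phi^+$ such that every positive root is a linear combination with non-negative coefficients of elements of $\Delta$; the set of simple reflections is $S_\Delta=\{s_\alpha:\alpha\in\Delta\}$, where $s_\alpha$ is the reflection on the hyperplane orthogonal to $\alpha$. $S_\Delta$ generates $R$. Left-reflection bigraphs. For $k\geq 1$ and $S_0,S_1,\ldots,S_k\subseteq S_\Delta$, let $R_i$ be the subgroup of $R$ generated by $S_i$. The $(S_0;S_1,\ldots,S_k;S_\Delta)$-left-reflection bigraph $G$ is given by $V_1(G)=R/R_0=\{rR_0: r\in R\}$ (left cosets), $V_2(G)=\{(rR_i,i): r\in R, 1\leq i\leq k\}$,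 $E(G)=\{(rR_0,(rR_i,i)): r\in R, 1\leq i\leq k\}$. Its natural coloring is $c:E(G)\to\{1,\ldots,k\}$, $c(rR_0,(rR_i,i))=i$. A left-reflection bigraph is any bigraph arising this way (for some $R$, ordered basis, and $S_0,\ldots,S_k$). Colored bigraphs. A colored bigraph is a pair $H=(G,c)$ with $G$ a bigraph and $c:E(G)\to C$ a function (coloring). It is right-uniform if $c(v,w)=f(w)$ for some function $f:V_2(G)\to C$. An automorphism of $H$ is an automorphism $\sigma$ of $G$ (bijection of $V(G)$ preserving $V_1(G)$, $V_2(G)$, edges and non-edges) with $c(\sigma(v),\sigma(w))=c(v,w)$ for all $(v,w)\in E(G)$. $H$ is color-edge-transitive if for all $(v_1,w_1),(v_2,w_2)\in E(G)$ with $c(v_1,w_1)=c(v_2,w_2)$ there is an automorphism $\sigma$ of $H$ with $\sigma(v_1)=v_2$ and $\sigma(w_1)=w_2$. Given probability spaces $\Omega=(X,\mu)$ and $\Lambda=(Y,\nu)$, a bigraphon over $\Omega$ and $\Lambda$ is a bounded measurable function $W:X\times Y\to\mathbb{R}_+=[0,\infty)$. For a sequence $W=(W_i)_{i\in C}$ of bigraphons all over the same spaces, $$t((G,c),W)=\int_{X^{V_1(G)}\times Y^{V_2(G)}}\prod_{(v,w)\in E(G)}W_{c(v,w)}(x_v,y_w)\,d(\mu\otimes\nu)(x,y).$$ A left-coloring of $G$ is a function $\ell:V_1(G)\to C'$; the coloring $\ell\otimes c:E(G)\to C'\times C$ is $(\ell\otimes c)(v,w)=(\ell(v),c(v,w))$.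 $(G,c)$ is left-weakly Hölder if for every left-coloring $\ell:V_1(G)\to C'$ and every sequence of bigraphons $W=(W_i)_{i\in C'\times C}$ all over the same spaces, $$t((G,\ell\otimes c),W)\leq\prod_{v\in V_1(G)}t((G,\ell(v)\otimes c),W)^{1/v_1(G)},$$ where $\ell(v)$ on the right-hand side denotes the constant left-coloring equal to $\ell(v)$. *)

theory Defs
  imports
    "HOL-Probability.Probability"
    "HOL-Algebra.Generated_Groups"
    "HOL-Algebra.Left_Coset"
begin

section \<open>Bigraphs and colored bigraphs\<close>

record 'v bigraph =
  left_verts :: "'v set"
  right_verts :: "'v set"
  edges :: "('v \<times> 'v) set"

definition bigraph :: "'v bigraph \<Rightarrow> bool" where
  "bigraph G \<longleftrightarrow>
     finite (left_verts G) \<and> finite (right_verts G) \<and>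
     left_verts G \<inter> right_verts G = {} \<and>
     edges G \<subseteq> left_verts G \<times> right_verts G"

definition verts :: "'v bigraph \<Rightarrow> 'v set" where
  "verts G = left_verts G \<union> right_verts G"

text \<open>A coloring \<open>c : E(G) \<rightarrow> C\<close> is a total function of which only the values on \<^term>\<open>edges G\<close>
  matter.\<close>

definition colored_bigraph :: "'v bigraph \<Rightarrow> 'c set \<Rightarrow> ('v \<times> 'v \<Rightarrow> 'c) \<Rightarrow> bool" where
  "colored_bigraph G C c \<longleftrightarrow> bigraph G \<and> c \<in> edges G \<rightarrow> C"

definition right_uniform :: "'v bigraph \<Rightarrow> 'c set \<Rightarrow> ('v \<times> 'v \<Rightarrow> 'c) \<Rightarrow> bool" where
  "right_uniform G C c \<longleftrightarrow>
     (\<exists>f \<in> right_verts G \<rightarrow> C. \<forall>(v, w) \<in> edges G. c (v, w) = f w)"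

definition bigraph_automorphism :: "'v bigraph \<Rightarrow> ('v \<Rightarrow> 'v) \<Rightarrow> bool" where
  "bigraph_automorphism G \<sigma> \<longleftrightarrow>
     bij_betw \<sigma> (verts G) (verts G) \<and>
     \<sigma> ` left_verts G = left_verts G \<and> \<sigma> ` right_verts G = right_verts G \<and>
     (\<forall>v \<in> left_verts G. \<forall>w \<in> right_verts G. (\<sigma> v, \<sigma> w) \<in> edges G \<longleftrightarrow> (v, w) \<in> edges G)"

definition colored_automorphism :: "'v bigraph \<Rightarrow> ('v \<times> 'v \<Rightarrow> 'c) \<Rightarrow> ('v \<Rightarrow> 'v) \<Rightarrow> bool" where
  "colored_automorphism G c \<sigma> \<longleftrightarrow>
     bigraph_automorphism G \<sigma> \<and> (\<forall>(v, w) \<in> edges G. c (\<sigma> v, \<sigma> w) = c (v, w))"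

definition color_edge_transitive :: "'v bigraph \<Rightarrow> ('v \<times> 'v \<Rightarrow> 'c) \<Rightarrow> bool" where
  "color_edge_transitive G c \<longleftrightarrow>
     (\<forall>(v1, w1) \<in> edges G. \<forall>(v2, w2) \<in> edges G. c (v1, w1) = c (v2, w2) \<longrightarrow>
        (\<exists>\<sigma>. colored_automorphism G c \<sigma> \<and> \<sigma> v1 = v2 \<and> \<sigma> w1 = w2))"

section \<open>Bigraphons and the left-weak Hoelder property\<close>

definition bigraphon :: "'x measure \<Rightarrow> 'y measure \<Rightarrow> ('x \<times> 'y \<Rightarrow> real) \<Rightarrow> bool" where
  "bigraphon \<Omega> \<Lambda> W \<longleftrightarrow>
     W \<in> borel_measurable (\<Omega> \<Otimes>\<^sub>M \<Lambda>) \<and>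
     (\<exists>B. \<forall>p \<in> space (\<Omega> \<Otimes>\<^sub>M \<Lambda>). 0 \<le> W p \<and> W p \<le> B)"

definition hom_density ::
  "'x measure \<Rightarrow> 'y measure \<Rightarrow> 'v bigraph \<Rightarrow> ('v \<times> 'v \<Rightarrow> 'c) \<Rightarrow> ('c \<Rightarrow> 'x \<times> 'y \<Rightarrow> real) \<Rightarrow> real"
where
  "hom_density \<Omega> \<Lambda> G c W =
     (\<integral>(x, y). (\<Prod>(v, w) \<in> edges G. W (c (v, w)) (x v, y w))
        \<partial>((\<Pi>\<^sub>M v \<in> left_verts G. \<Omega>) \<Otimes>\<^sub>M (\<Pi>\<^sub>M w \<in> right_verts G. \<Lambda>)))"

definition left_color_tensor ::
  "('v \<Rightarrow> 'l) \<Rightarrow> ('v \<times> 'v \<Rightarrow> 'c) \<Rightarrow> 'v \<times> 'v \<Rightarrow> 'l \<times> 'c"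
where
  "left_color_tensor l c = (\<lambda>(v, w). (l v, c (v, w)))"

text \<open>The type arguments are the ambient types of the left colors and of the two probability
  spaces; a quantification over all of them is only possible at the level of theorems, by leaving
  these types free.\<close>

definition left_weakly_Hoelder ::
  "'l itself \<Rightarrow> 'x itself \<Rightarrow> 'y itself \<Rightarrow> 'v bigraph \<Rightarrow> 'c set \<Rightarrow> ('v \<times> 'v \<Rightarrow> 'c) \<Rightarrow> bool"
where
  "left_weakly_Hoelder _ _ _ G C c \<longleftrightarrow>
     (\<forall>(C' :: 'l set) (l :: 'v \<Rightarrow> 'l) (\<Omega> :: 'x measure) (\<Lambda> :: 'y measure) W.
        l \<in> left_verts G \<rightarrow> C' \<longrightarrow> prob_space \<Omega> \<longrightarrow> prob_space \<Lambda> \<longrightarrow>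
        (\<forall>i \<in> C' \<times> C. bigraphon \<Omega> \<Lambda> (W i)) \<longrightarrow>
        hom_density \<Omega> \<Lambda> G (left_color_tensor l c) W \<le>
          (\<Prod>v \<in> left_verts G.
             hom_density \<Omega> \<Lambda> G (left_color_tensor (\<lambda>_. l v) c) W
               powr (1 / real (card (left_verts G)))))"

section \<open>Finite reflection groups\<close>

definition GL :: "(real^'n^'n) monoid" where
  "GL = \<lparr>carrier = {A. invertible A}, mult = (**), one = mat 1\<rparr>"

definition reflection :: "real^'n \<Rightarrow> real^'n^'n" where
  "reflection \<alpha> = matrix (\<lambda>x. x - (2 * (x \<bullet> \<alpha>) / (\<alpha> \<bullet> \<alpha>)) *\<^sub>R \<alpha>)"

definition is_reflection :: "real^'n^'n \<Rightarrow> bool" where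
  "is_reflection t \<longleftrightarrow> (\<exists>\<alpha>. \<alpha> \<noteq> 0 \<and> t = reflection \<alpha>)"

definition finite_reflection_group :: "(real^'n^'n) set \<Rightarrow> bool" where
  "finite_reflection_group R \<longleftrightarrow>
     subgroup R GL \<and> finite R \<and> (\<exists>A. (\<forall>t \<in> A. is_reflection t) \<and> R = generate GL A)"

definition root_system :: "(real^'n^'n) set \<Rightarrow> (real^'n) set" where
  "root_system R =
     {\<alpha>. norm \<alpha> = 1 \<and>
        (\<exists>t \<in> R. is_reflection t \<and>
           (\<exists>H. subspace H \<and> dim H = CARD('n) - 1 \<and>
              (\<forall>x \<in> H. t *v x = x) \<and> (\<forall>x \<in> H. orthogonal \<alpha> x)))}"

definition ordered_basis :: "(real^'n) list \<Rightarrow> bool" where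
  "ordered_basis us \<longleftrightarrow> distinct us \<and> independent (set us) \<and> span (set us) = UNIV"

definition positive_roots :: "(real^'n^'n) set \<Rightarrow> (real^'n) list \<Rightarrow> (real^'n) set" where
  "positive_roots R us =
     {\<alpha> \<in> root_system R.
        \<exists>c. \<alpha> = (\<Sum>i<length us. c i *\<^sub>R us ! i) \<and>
            (\<exists>i0<length us. c i0 > 0 \<and> (\<forall>i<i0. c i = 0))}"

text \<open>For a finite group \<open>R\<close> the root system is finite, so the sum below is a finite one.\<close>

definition nonneg_generates :: "(real^'n) set \<Rightarrow> (real^'n) set \<Rightarrow> bool" where
  "nonneg_generates D P \<longleftrightarrow>
     (\<forall>\<alpha> \<in> P. \<exists>c. (\<forall>\<delta> \<in> D. 0 \<le> c \<delta>) \<and> \<alpha> = (\<Sum>\<delta>\<in>D. c \<delta> *\<^sub>R \<delta>))"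

text \<open>Minimality is with respect to inclusion; it determines the simple system uniquely.\<close>

definition simple_system ::
  "(real^'n^'n) set \<Rightarrow> (real^'n) list \<Rightarrow> (real^'n) set \<Rightarrow> bool"
where
  "simple_system R us \<Delta> \<longleftrightarrow>
     \<Delta> \<subseteq> positive_roots R us \<and> nonneg_generates \<Delta> (positive_roots R us) \<and>
     (\<forall>D. D \<subset> \<Delta> \<longrightarrow> \<not> nonneg_generates D (positive_roots R us))"

definition simple_reflections :: "(real^'n) set \<Rightarrow> (real^'n^'n) set" where
  "simple_reflections \<Delta> = reflection ` \<Delta>"

section \<open>Left-reflection bigraphs\<close>

text \<open>A left vertex \<open>r R\<^sub>0\<close> is encoded as \<open>Inl (r R\<^sub>0)\<close> and a right vertex \<open>(r R\<^sub>i, i)\<close> as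
  \<open>Inr (r R\<^sub>i, i)\<close>, which keeps the two sides disjoint.\<close>

type_synonym 'n refl_vertex = "(real^'n^'n) set + (real^'n^'n) set \<times> nat"

definition parabolic :: "(nat \<Rightarrow> (real^'n^'n) set) \<Rightarrow> nat \<Rightarrow> (real^'n^'n) set" where
  "parabolic S i = generate GL (S i)"

definition left_reflection_bigraph ::
  "(real^'n^'n) set \<Rightarrow> (nat \<Rightarrow> (real^'n^'n) set) \<Rightarrow> nat \<Rightarrow> 'n refl_vertex bigraph"
where
  "left_reflection_bigraph R S k =
     \<lparr>left_verts = {Inl (r <#\<^bsub>GL\<^esub> parabolic S 0) | r. r \<in> R},
      right_verts = {Inr (r <#\<^bsub>GL\<^esub> parabolic S i, i) | r i. r \<in> R \<and> 1 \<le> i \<and> i \<le> k},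
      edges = {(Inl (r <#\<^bsub>GL\<^esub> parabolic S 0), Inr (r <#\<^bsub>GL\<^esub> parabolic S i, i)) | r i.
                 r \<in> R \<and> 1 \<le> i \<and> i \<le> k}\<rparr>"

definition natural_coloring :: "'n refl_vertex \<times> 'n refl_vertex \<Rightarrow> nat" where
  "natural_coloring = (\<lambda>(v, w). snd (projr w))"

lemma colored_bigraph_left_reflection_bigraph:
  assumes "finite R"
  shows "colored_bigraph (left_reflection_bigraph R S k) {1..k} natural_coloring"
proof -
  let ?g = "\<lambda>(r, i). Inr (r <#\<^bsub>GL\<^esub> parabolic S i, i)"
  have "right_verts (left_reflection_bigraph R S k) = ?g ` (R \<times> {1..k})"
    by (auto simp: left_reflection_bigraph_def)
  then have "finite (right_verts (left_reflection_bigraph R S k))"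
    using assms by simp
  then show ?thesis
    using assms
    by (auto simp: colored_bigraph_def bigraph_def left_reflection_bigraph_def
        natural_coloring_def)
qed

end

theory Submission
  imports Defs
begin

text \<open>A reflection \<open>s\<^sub>\<beta>\<close> of the group acts on the bigraph by left multiplication. A coset that it does
  not fix lies entirely on one side of its mirror, and no edge joins the two sides, because adjacent
  cosets share an element. By Cauchy-Schwarz the density of a left-colored bigraph is therefore at most
  the geometric mean of the densities of the two colorings obtained by copying one side onto the other.
  Folding along mirrors \<open>A \<delta>\<close> with \<open>\<delta>\<close> simple spreads the color of the coset of \<open>A\<close> over all left
  vertices, by the exchange condition. Hence a coloring that maximizes the ratio of the two sides of the
  Hoelder inequality can be replaced by a constant one, for which the ratio is \<open>1\<close>.\<close>

section \<open>Folds and Cauchy-Schwarz\<close>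

text \<open>The bound for one fold compares a coloring with two others, neither of which need be
  closer to a constant one, so iterating it from an arbitrary coloring controls nothing. Maximality
  of the ratio removes this obstacle: the product of the two new ratios is at least the square of
  the maximum, so both folds are maximizers again and the direction may be chosen freely at every
  step. The right-hand side of the inequality cooperates because the two folds together use each
  color on the left vertices exactly twice as often as the original coloring. A second obstacle is
  that a fold overwrites a whole side, including vertices that already have the desired color.
  Adding cosets in order of increasing word length avoids harm: an overwritten coset takes its color
  from one that is strictly shorter and therefore already correct. Percolation is needed for two
  different properties of colorings, positive density and maximal ratio, and is therefore formulated
  for an arbitrary predicate \<open>Q\<close> preserved by folds.\<close>

definition fold_coloring :: "('v \<Rightarrow> 'v) \<Rightarrow> 'v set \<Rightarrow> ('v \<Rightarrow> 'l) \<Rightarrow> 'v \<Rightarrow> 'l" where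
  "fold_coloring \<sigma> N m = (\<lambda>v. if v \<in> N then m (\<sigma> v) else m v)"

text \<open>Left and right vertices are treated alike, and the condition is symmetric in
  \<open>P\<close> and \<open>N\<close>, so that either side may be copied onto the other. The fixed
  set \<open>V - P - N\<close> separates the two sides, which is the source of the conditional
  independence used below.\<close>

definition is_fold ::
  "'v set \<Rightarrow> ('v \<times> 'v) set \<Rightarrow> ('v \<times> 'v \<Rightarrow> 'c) \<Rightarrow> ('v \<Rightarrow> 'v) \<Rightarrow> 'v set \<Rightarrow> 'v set \<Rightarrow> bool"
where
  "is_fold V E c \<sigma> P N \<longleftrightarrow>
     P \<subseteq> V \<and> N \<subseteq> V \<and> P \<inter> N = {} \<and> \<sigma> \<in> P \<rightarrow> N \<and> \<sigma> \<in> N \<rightarrow> P \<and>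
     (\<forall>v \<in> V. \<sigma> (\<sigma> v) = v) \<and> (\<forall>v \<in> V - P - N. \<sigma> v = v) \<and>
     (\<forall>v w. (v, w) \<in> E \<longrightarrow> (\<sigma> v, \<sigma> w) \<in> E \<and> c (\<sigma> v, \<sigma> w) = c (v, w) \<and>
        \<not> (v \<in> P \<and> w \<in> N) \<and> \<not> (v \<in> N \<and> w \<in> P))"

text \<open>All vertices carry variables from one space \<Theta>, so that the two sides of the
  bigraph need no separate bookkeeping; \<open>K a i\<close> is the kernel for left color
  \<open>a\<close> and edge color \<open>i\<close>. Values in \<open>ennreal\<close> give access to
  Tonelli and Cauchy-Schwarz without integrability conditions.\<close>

locale kernel_density = prob_space \<Theta>
  for \<Theta> :: "'z measure" +
  fixes V :: "'v set" and E :: "('v \<times> 'v) set" and c :: "'v \<times> 'v \<Rightarrow> 'c"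
    and K :: "'l \<Rightarrow> 'c \<Rightarrow> 'z \<Rightarrow> 'z \<Rightarrow> ennreal"
  assumes finite_V: "finite V" and E_subset: "E \<subseteq> V \<times> V"
    and K_measurable: "\<And>a i. (\<lambda>(z, z'). K a i z z') \<in> borel_measurable (\<Theta> \<Otimes>\<^sub>M \<Theta>)"
begin

definition kernel_prod :: "('v \<times> 'v) set \<Rightarrow> ('v \<Rightarrow> 'l) \<Rightarrow> ('v \<Rightarrow> 'z) \<Rightarrow> ennreal" where
  "kernel_prod D m z = (\<Prod>(v, w) \<in> D. K (m v) (c (v, w)) (z v) (z w))"

definition density_of :: "('v \<Rightarrow> 'l) \<Rightarrow> ennreal" where
  "density_of m = (\<integral>\<^sup>+ z. kernel_prod E m z \<partial>PiM V (\<lambda>_. \<Theta>))"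

lemma finite_E: "finite E"
  using finite_V E_subset finite_subset by blast

lemma kernel_measurable:
  assumes "f \<in> measurable M \<Theta>" "g \<in> measurable M \<Theta>"
  shows "(\<lambda>x. K a i (f x) (g x)) \<in> borel_measurable M"
  using measurable_compose[OF measurable_Pair[OF assms] K_measurable[of a i]] by simp

lemma kernel_prod_measurable:
  assumes "D \<subseteq> U \<times> U"
  shows "kernel_prod D m \<in> borel_measurable (PiM U (\<lambda>_. \<Theta>))"
  unfolding kernel_prod_def
proof (rule borel_measurable_prod_ennreal)
  fix e assume "e \<in> D"
  with assms obtain v w where "e = (v, w)" "v \<in> U" "w \<in> U" by auto
  then show "(\<lambda>z. case e of (v, w) \<Rightarrow> K (m v) (c (v, w)) (z v) (z w))
      \<in> borel_measurable (PiM U (\<lambda>_. \<Theta>))"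
    by (auto intro!: kernel_measurable measurable_component_singleton)
qed

lemma kernel_prod_cong:
  assumes "\<And>v w. (v, w) \<in> D \<Longrightarrow> m v = m' v \<and> z v = z' v \<and> z w = z' w"
  shows "kernel_prod D m z = kernel_prod D m' z'"
  unfolding kernel_prod_def by (intro prod.cong refl) (use assms in \<open>auto split: prod.split\<close>)

lemma density_of_cong:
  assumes "\<And>v w. (v, w) \<in> E \<Longrightarrow> m v = m' v"
  shows "density_of m = density_of m'"
  unfolding density_of_def by (intro nn_integral_cong kernel_prod_cong) (simp add: assms)

lemma product_sigma_finite: "product_sigma_finite (\<lambda>_ :: 'v. \<Theta>)"
  by (simp add: product_sigma_finite_def sigma_finite_measure_axioms)

text \<open>Conditionally on the variables at the vertices fixed by \<open>\<sigma>\<close>, those at \<open>P\<close> and at \<open>N\<close> are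
  independent, so that the density is \<open>\<integral> f a b\<close> with \<open>a\<close> and \<open>b\<close> the two conditional expectations; this
  is bounded by Cauchy-Schwarz, and \<open>\<integral> f a\<^sup>2\<close> and \<open>\<integral> f b\<^sup>2\<close> are the densities of the folded colorings.\<close>

lemma density_of_fold:
  assumes fold: "is_fold V E c \<sigma> P N"
  shows "(density_of m)\<^sup>2 \<le>
    density_of (fold_coloring \<sigma> N m) * density_of (fold_coloring \<sigma> P m)"
proof -
  interpret product_sigma_finite "\<lambda>_ :: 'v. \<Theta>" by (rule product_sigma_finite)
  define F where "F = V - P - N"
  define EF where "EF = E \<inter> F \<times> F"
  \<comment> \<open>Removing \<open>F \<times> F\<close> keeps the edges between fixed vertices out
    of both \<open>EP\<close> and \<open>EN\<close>. As no edge joins \<open>P\<close> and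
    \<open>N\<close>, each edge then belongs to exactly one of \<open>EF\<close>, \<open>EP\<close>,
    \<open>EN\<close>.\<close>
  define EP where "EP = E \<inter> (P \<union> F) \<times> (P \<union> F) - F \<times> F"
  define EN where "EN = E \<inter> (N \<union> F) \<times> (N \<union> F) - F \<times> F"
  have sub: "P \<subseteq> V" "N \<subseteq> V" "P \<inter> N = {}"
    and \<sigma>P: "\<And>v. v \<in> P \<Longrightarrow> \<sigma> v \<in> N" and \<sigma>N: "\<And>v. v \<in> N \<Longrightarrow> \<sigma> v \<in> P"
    and \<sigma>2: "\<And>v. v \<in> V \<Longrightarrow> \<sigma> (\<sigma> v) = v" and \<sigma>F: "\<And>v. v \<in> F \<Longrightarrow> \<sigma> v = v"
    and \<sigma>E: "\<And>v w. (v, w) \<in> E \<Longrightarrow> (\<sigma> v, \<sigma> w) \<in> E"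
    and \<sigma>c: "\<And>v w. (v, w) \<in> E \<Longrightarrow> c (\<sigma> v, \<sigma> w) = c (v, w)"
    and sep: "\<And>v w. (v, w) \<in> E \<Longrightarrow> \<not> (v \<in> P \<and> w \<in> N) \<and> \<not> (v \<in> N \<and> w \<in> P)"
    using fold by (auto simp: is_fold_def F_def)
  have \<sigma>P': "\<sigma> v \<notin> P" if "v \<in> P" for v
    using that sub \<sigma>P by blast
  have fin: "finite F" "finite P" "finite N" "finite EF" "finite EP" "finite EN"
    using finite_V finite_E sub by (auto simp: F_def EF_def EP_def EN_def finite_subset)
  have V: "V = (F \<union> P) \<union> N" and disj: "F \<inter> P = {}" "(F \<union> P) \<inter> N = {}"
    using sub by (auto simp: F_def)
  have E_split: "E = EF \<union> (EP \<union> EN)"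
    using E_subset sep unfolding EF_def EP_def EN_def V by blast
  have kp_split: "kernel_prod E m' z = kernel_prod EF m' z * (kernel_prod EP m' z * kernel_prod EN m' z)"
    for m' z
  proof -
    have "EP \<inter> EN = {}" "EF \<inter> (EP \<union> EN) = {}"
      using disj by (auto simp: EF_def EP_def EN_def)
    then show ?thesis
      using fin by (simp add: kernel_prod_def E_split prod.union_disjoint)
  qed
  \<comment> \<open>\<sigma> exchanges \<open>EN\<close> and \<open>EP\<close>, so the factor of the
    \<open>N\<close> side is that of the \<open>P\<close> side for the transported coloring and
    variables. Hence a single function \<open>A\<close> below describes both conditional
    expectations.\<close>
  have EN_eq: "kernel_prod EN m' z = kernel_prod EP (m' \<circ> \<sigma>) (z \<circ> \<sigma>)" for m' z
    unfolding kernel_prod_def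
  proof (rule prod.reindex_bij_witness[where i = "\<lambda>(v, w). (\<sigma> v, \<sigma> w)" and j = "\<lambda>(v, w). (\<sigma> v, \<sigma> w)"])
    fix e assume "e \<in> EN"
    then obtain v w where e: "e = (v, w)" "(v, w) \<in> EN" by (cases e) auto
    then have "v \<in> V" "w \<in> V" using E_subset by (auto simp: EN_def)
    then show "(case case e of (v, w) \<Rightarrow> (\<sigma> v, \<sigma> w) of (v, w) \<Rightarrow> (\<sigma> v, \<sigma> w)) = e"
      using e \<sigma>2 by simp
    show "(case e of (v, w) \<Rightarrow> (\<sigma> v, \<sigma> w)) \<in> EP"
      using e \<sigma>N \<sigma>F \<sigma>E disj by (auto simp: EN_def EP_def)
    show "(case case e of (v, w) \<Rightarrow> (\<sigma> v, \<sigma> w) of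
         (v, w) \<Rightarrow> K ((m' \<circ> \<sigma>) v) (c (v, w)) ((z \<circ> \<sigma>) v) ((z \<circ> \<sigma>) w)) =
        (case e of (v, w) \<Rightarrow> K (m' v) (c (v, w)) (z v) (z w))"
      using e \<sigma>2 \<sigma>c \<open>v \<in> V\<close> \<open>w \<in> V\<close> by (auto simp: EN_def)
  next
    fix e assume "e \<in> EP"
    then obtain v w where e: "e = (v, w)" "(v, w) \<in> EP" by (cases e) auto
    then have "v \<in> V" "w \<in> V" using E_subset by (auto simp: EP_def)
    then show "(case case e of (v, w) \<Rightarrow> (\<sigma> v, \<sigma> w) of (v, w) \<Rightarrow> (\<sigma> v, \<sigma> w)) = e"
      using e \<sigma>2 by simp
    show "(case e of (v, w) \<Rightarrow> (\<sigma> v, \<sigma> w)) \<in> EN"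
      using e \<sigma>P \<sigma>F \<sigma>E disj by (auto simp: EN_def EP_def)
  qed
  define f where "f = kernel_prod EF"
  \<comment> \<open>The variables at \<open>P\<close> are integrated out with those at
    \<open>F\<close> held fixed; the counterpart for \<open>N\<close> is
    \<open>A (m' \<circ> \<sigma>)\<close>.\<close>
  define A where "A = (\<lambda>m' x. \<integral>\<^sup>+ y. kernel_prod EP m' (merge F P (x, y)) \<partial>PiM P (\<lambda>_. \<Theta>))"
  have meas_f: "f m' \<in> borel_measurable (PiM F (\<lambda>_. \<Theta>))" for m'
    unfolding f_def by (rule kernel_prod_measurable) (auto simp: EF_def)
  have meas_EP: "kernel_prod EP m' \<in> borel_measurable (PiM (F \<union> P) (\<lambda>_. \<Theta>))" for m'
    by (rule kernel_prod_measurable) (auto simp: EP_def)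
  have meas_EP': "(\<lambda>(x, y). kernel_prod EP m' (merge F P (x, y)))
      \<in> borel_measurable (PiM F (\<lambda>_. \<Theta>) \<Otimes>\<^sub>M PiM P (\<lambda>_. \<Theta>))" for m'
    using measurable_compose[OF measurable_merge meas_EP] by (simp add: split_beta')
  have meas_y: "(\<lambda>y. kernel_prod EP m' (merge F P (x, y))) \<in> borel_measurable (PiM P (\<lambda>_. \<Theta>))"
    if "x \<in> space (PiM F (\<lambda>_. \<Theta>))" for x m'
    using measurable_compose[OF measurable_Pair1'[OF that] meas_EP'] by simp
  interpret PP: prob_space "PiM P (\<lambda>_. \<Theta>)" by (intro prob_space_PiM) (rule prob_space_axioms)
  have meas_A: "A m' \<in> borel_measurable (PiM F (\<lambda>_. \<Theta>))" for m'
    unfolding A_def using PP.borel_measurable_nn_integral[OF meas_EP'] by simp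
  have inner: "(\<integral>\<^sup>+ y'. kernel_prod EP m' (merge (F \<union> P) N (x, y') \<circ> \<sigma>) \<partial>PiM N (\<lambda>_. \<Theta>))
      = A m' x" if x: "x \<in> space (PiM (F \<union> P) (\<lambda>_. \<Theta>))" for x m'
  proof -
    let ?x = "restrict x F" and ?r = "\<lambda>y'. \<lambda>n\<in>P. y' (\<sigma> n)"
    have x': "?x \<in> space (PiM F (\<lambda>_. \<Theta>))"
      using x by (auto simp: space_PiM PiE_def)
    have "kernel_prod EP m' (merge (F \<union> P) N (x, y') \<circ> \<sigma>) = kernel_prod EP m' (merge F P (?x, ?r y'))" for y'
      using disj \<sigma>P \<sigma>F by (intro kernel_prod_cong) (auto simp: EP_def merge_def)
    then have "(\<integral>\<^sup>+ y'. kernel_prod EP m' (merge (F \<union> P) N (x, y') \<circ> \<sigma>) \<partial>PiM N (\<lambda>_. \<Theta>))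
        = (\<integral>\<^sup>+ y'. kernel_prod EP m' (merge F P (?x, ?r y')) \<partial>PiM N (\<lambda>_. \<Theta>))"
      by simp
    also have "\<dots> = (\<integral>\<^sup>+ y. kernel_prod EP m' (merge F P (?x, y))
        \<partial>distr (PiM N (\<lambda>_. \<Theta>)) (PiM P (\<lambda>_. \<Theta>)) ?r)"
      by (rule nn_integral_distr[symmetric])
        (intro measurable_restrict measurable_component_singleton \<sigma>P, assumption,
          simp only: measurable_distr_eq1, rule meas_y[OF x'])
    also have "distr (PiM N (\<lambda>_. \<Theta>)) (PiM P (\<lambda>_. \<Theta>)) ?r = PiM P (\<lambda>_. \<Theta>)"
    proof (rule distr_PiM_reindex[where M = "\<lambda>_. \<Theta>"])
      show "inj_on \<sigma> P" by (rule inj_on_inverseI[where g = \<sigma>]) (use \<sigma>2 sub in auto)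
    qed (use \<sigma>P prob_space_axioms in auto)
    also have "(\<integral>\<^sup>+ y. kernel_prod EP m' (merge F P (?x, y)) \<partial>PiM P (\<lambda>_. \<Theta>)) = A m' x"
      by (simp add: A_def merge_def restrict_def cong: if_cong)
    finally show ?thesis .
  qed
  have key: "density_of m' = (\<integral>\<^sup>+ x. f m' x * (A m' x * A (m' \<circ> \<sigma>) x) \<partial>PiM F (\<lambda>_. \<Theta>))" for m'
  proof -
    have "density_of m' = (\<integral>\<^sup>+ x. \<integral>\<^sup>+ y'. kernel_prod E m' (merge (F \<union> P) N (x, y'))
        \<partial>PiM N (\<lambda>_. \<Theta>) \<partial>PiM (F \<union> P) (\<lambda>_. \<Theta>))"
      unfolding density_of_def
      by (rule product_nn_integral_fold[of "F \<union> P" N, folded V])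
        (use fin disj E_subset in \<open>auto intro!: kernel_prod_measurable\<close>)
    also have "\<dots> = (\<integral>\<^sup>+ x. kernel_prod EF m' x * (kernel_prod EP m' x * A (m' \<circ> \<sigma>) x)
        \<partial>PiM (F \<union> P) (\<lambda>_. \<Theta>))"
    proof (rule nn_integral_cong)
      fix x assume x: "x \<in> space (PiM (F \<union> P) (\<lambda>_. \<Theta>))"
      let ?z = "\<lambda>y'. merge (F \<union> P) N (x, y')"
      have "kernel_prod EF m' (?z y') = kernel_prod EF m' x"
        "kernel_prod EP m' (?z y') = kernel_prod EP m' x" for y'
        using disj by (auto intro!: kernel_prod_cong simp: EF_def EP_def merge_def)
      then have "(\<integral>\<^sup>+ y'. kernel_prod E m' (?z y') \<partial>PiM N (\<lambda>_. \<Theta>)) = (\<integral>\<^sup>+ y'. kernel_prod EF m' x *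
          kernel_prod EP m' x * kernel_prod EP (m' \<circ> \<sigma>) (?z y' \<circ> \<sigma>) \<partial>PiM N (\<lambda>_. \<Theta>))"
        by (simp add: kp_split EN_eq mult.assoc)
      also have "\<dots> = kernel_prod EF m' x * kernel_prod EP m' x *
          (\<integral>\<^sup>+ y'. kernel_prod EP (m' \<circ> \<sigma>) (?z y' \<circ> \<sigma>) \<partial>PiM N (\<lambda>_. \<Theta>))"
      proof (rule nn_integral_cmult)
        have "kernel_prod EN m' \<in> borel_measurable (PiM ((F \<union> P) \<union> N) (\<lambda>_. \<Theta>))"
          by (rule kernel_prod_measurable) (auto simp: EN_def)
        then have "(\<lambda>y'. kernel_prod EN m' (?z y')) \<in> borel_measurable (PiM N (\<lambda>_. \<Theta>))"
          by (rule measurable_compose[OF measurable_compose[OF measurable_Pair1'[OF x] measurable_merge]])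
        then show "(\<lambda>y'. kernel_prod EP (m' \<circ> \<sigma>) (?z y' \<circ> \<sigma>)) \<in> borel_measurable (PiM N (\<lambda>_. \<Theta>))"
          by (simp add: EN_eq)
      qed
      finally show "(\<integral>\<^sup>+ y'. kernel_prod E m' (?z y') \<partial>PiM N (\<lambda>_. \<Theta>)) =
          kernel_prod EF m' x * (kernel_prod EP m' x * A (m' \<circ> \<sigma>) x)"
        by (simp add: inner[OF x] mult.assoc)
    qed
    also have "\<dots> = (\<integral>\<^sup>+ x. \<integral>\<^sup>+ y. kernel_prod EF m' (merge F P (x, y)) *
        (kernel_prod EP m' (merge F P (x, y)) * A (m' \<circ> \<sigma>) (merge F P (x, y)))
        \<partial>PiM P (\<lambda>_. \<Theta>) \<partial>PiM F (\<lambda>_. \<Theta>))"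
    proof (rule product_nn_integral_fold)
      have "A m'' \<in> borel_measurable (PiM (F \<union> P) (\<lambda>_. \<Theta>))" for m''
      proof -
        \<comment> \<open>\<open>A\<close> is measurable over the coordinates in \<open>F\<close>,
          but is read here over those in \<open>F \<union> P\<close>; \<open>merge\<close> looks at
          its first argument only on \<open>F\<close>.\<close>
        have "A m'' = (\<lambda>x. A m'' (restrict x F))"
          by (simp add: A_def merge_def restrict_def fun_eq_iff cong: if_cong)
        also have "\<dots> \<in> borel_measurable (PiM (F \<union> P) (\<lambda>_. \<Theta>))"
          by (rule measurable_compose[OF measurable_restrict_subset meas_A]) simp
        finally show ?thesis .
      qed
      moreover have "kernel_prod EF m' \<in> borel_measurable (PiM (F \<union> P) (\<lambda>_. \<Theta>))"
        by (rule kernel_prod_measurable) (auto simp: EF_def)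
      ultimately show "(\<lambda>x. kernel_prod EF m' x * (kernel_prod EP m' x * A (m' \<circ> \<sigma>) x))
          \<in> borel_measurable (PiM (F \<union> P) (\<lambda>_. \<Theta>))"
        using meas_EP by (intro borel_measurable_times_ennreal)
    qed (use disj fin in auto)
    also have "\<dots> = (\<integral>\<^sup>+ x. f m' x * (A m' x * A (m' \<circ> \<sigma>) x) \<partial>PiM F (\<lambda>_. \<Theta>))"
    proof (rule nn_integral_cong)
      fix x assume x: "x \<in> space (PiM F (\<lambda>_. \<Theta>))"
      have "kernel_prod EF m' (merge F P (x, y)) = f m' x"
        "A (m' \<circ> \<sigma>) (merge F P (x, y)) = A (m' \<circ> \<sigma>) x" for y
        by (auto intro!: kernel_prod_cong nn_integral_cong simp: f_def A_def EF_def merge_def)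
      then show "(\<integral>\<^sup>+ y. kernel_prod EF m' (merge F P (x, y)) * (kernel_prod EP m' (merge F P (x, y)) *
            A (m' \<circ> \<sigma>) (merge F P (x, y))) \<partial>PiM P (\<lambda>_. \<Theta>)) = f m' x * (A m' x * A (m' \<circ> \<sigma>) x)"
        using meas_y[OF x] by (simp add: nn_integral_cmult nn_integral_multc) (simp add: A_def)
    qed
    finally show ?thesis .
  qed
  have A_cong: "A m1 = A m2" if "\<And>v. v \<in> P \<union> F \<Longrightarrow> m1 v = m2 v" for m1 m2
    unfolding A_def using kernel_prod_cong[of EP m1 m2] that by (simp add: EP_def)
  have f_cong: "f m1 = f m2" if "\<And>v. v \<in> F \<Longrightarrow> m1 v = m2 v" for m1 m2
    unfolding f_def using kernel_prod_cong[of EF m1 m2] that by (auto simp: EF_def)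
  \<comment> \<open>Folding leaves the colors on \<open>F\<close> alone, so the weight
    \<open>f\<close> is the same for \<open>m\<close> and for both folded colorings. Absorbing it
    into the measure reduces the claim to Cauchy-Schwarz without a weight.\<close>
  define M where "M = density (PiM F (\<lambda>_. \<Theta>)) (f m)"
  have dens: "density_of m' = (\<integral>\<^sup>+ x. A m' x * A (m' \<circ> \<sigma>) x \<partial>M)"
    if "\<And>v. v \<in> F \<Longrightarrow> m' v = m v" for m'
  proof -
    have "f m' = f m" using that by (rule f_cong)
    then show ?thesis
      unfolding M_def key using meas_f meas_A
      by (subst nn_integral_density) (auto intro!: borel_measurable_times_ennreal)
  qed
  let ?p = "fold_coloring \<sigma> N m" and ?n = "fold_coloring \<sigma> P m"
  have "density_of ?p = (\<integral>\<^sup>+ x. (A m x)\<^sup>2 \<partial>M)"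
  proof -
    \<comment> \<open>The folded coloring is invariant under \<sigma>, so its two halves contribute
      the same factor and the product becomes a square.\<close>
    have "A ?p = A m" "A (?p \<circ> \<sigma>) = A m"
      using disj \<sigma>P \<sigma>F \<sigma>2 sub by (auto intro!: A_cong simp: fold_coloring_def subset_iff)
    then show ?thesis
      using disj by (subst dens) (auto simp: fold_coloring_def power2_eq_square)
  qed
  moreover have "density_of ?n = (\<integral>\<^sup>+ x. (A (m \<circ> \<sigma>) x)\<^sup>2 \<partial>M)"
  proof -
    have "A ?n = A (m \<circ> \<sigma>)" "A (?n \<circ> \<sigma>) = A (m \<circ> \<sigma>)"
      using disj \<sigma>P' \<sigma>F \<sigma>2 sub by (auto intro!: A_cong simp: fold_coloring_def)
    then show ?thesis
      using disj by (subst dens) (auto simp: fold_coloring_def power2_eq_square)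
  qed
  moreover have "(density_of m)\<^sup>2 \<le> (\<integral>\<^sup>+ x. (A m x)\<^sup>2 \<partial>M) * (\<integral>\<^sup>+ x. (A (m \<circ> \<sigma>) x)\<^sup>2 \<partial>M)"
    unfolding dens[OF refl] by (rule Cauchy_Schwarz_nn_integral) (simp_all add: M_def meas_A)
  ultimately show ?thesis by simp
qed

text \<open>Finiteness is essential in the passage to real numbers, because \<open>enn2real\<close>
  sends infinity to 0 and is monotone only below a finite bound.\<close>

lemma enn2real_density_of_fold:
  assumes "is_fold V E c \<sigma> P N" and finite_density: "\<And>m. density_of m < \<infinity>"
  shows "(enn2real (density_of m))\<^sup>2 \<le>
    enn2real (density_of (fold_coloring \<sigma> N m)) * enn2real (density_of (fold_coloring \<sigma> P m))"
proof -
  have "enn2real ((density_of m)\<^sup>2) \<le>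
      enn2real (density_of (fold_coloring \<sigma> N m) * density_of (fold_coloring \<sigma> P m))"
    using density_of_fold[OF assms(1), of m] finite_density
    by (intro enn2real_mono) (auto simp: ennreal_mult_less_top)
  then show ?thesis
    by (simp add: enn2real_mult power2_eq_square)
qed

text \<open>The ratio \<open>\<rho>\<close> of the two sides of the inequality satisfies the Cauchy-Schwarz inequality of the
  folds, so folding preserves its maximizers; percolation turns a maximizer into a constant coloring,
  where \<open>\<rho> = 1\<close>. Positivity of the denominator is obtained by percolation as well.\<close>

lemma percolation_imp_Hoelder:
  assumes L: "L \<noteq> {}" "L \<subseteq> V" "E \<subseteq> L \<times> V"
    and finite_density: "\<And>m. density_of m < \<infinity>"
    and folds: "\<And>\<sigma> P N. (\<sigma>, P, N) \<in> \<F> \<Longrightarrow> is_fold V E c \<sigma> P N \<and> \<sigma> \<in> L \<rightarrow> L"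
    and percolation: "\<And>Q m v0. Q m \<Longrightarrow> v0 \<in> L \<Longrightarrow>
      (\<And>m' \<sigma> P N. Q m' \<Longrightarrow> (\<sigma>, P, N) \<in> \<F> \<Longrightarrow> Q (fold_coloring \<sigma> N m')) \<Longrightarrow>
      \<exists>m' :: 'v \<Rightarrow> 'l. Q m' \<and> (\<forall>v \<in> L. m' v = m v0)"
  shows "enn2real (density_of m) \<le>
    (\<Prod>v \<in> L. enn2real (density_of (\<lambda>_. m v)) powr (1 / real (card L)))"
proof (cases "enn2real (density_of m) = 0")
  case True
  then show ?thesis by (simp add: prod_nonneg)
next
  case False
  define \<tau> where "\<tau> m' = enn2real (density_of m')" for m'
  \<comment> \<open>The root is chosen so that \<open>card L\<close> equal factors multiply to the
    density of a constant coloring, which makes \<rho> equal to 1 there.\<close>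
  define \<kappa> where "\<kappa> a = \<tau> (\<lambda>_. a) powr (1 / real (card L))" for a
  define \<rho> where "\<rho> m' = \<tau> m' / (\<Prod>v \<in> L. \<kappa> (m' v))" for m'
  define A where "A = m ` L"
  have \<tau>_nonneg: "\<tau> m' \<ge> 0" for m' by (simp add: \<tau>_def)
  have \<tau>_cong: "\<tau> m1 = \<tau> m2" if "\<And>v. v \<in> L \<Longrightarrow> m1 v = m2 v" for m1 m2
    unfolding \<tau>_def using that L by (intro arg_cong[where f = enn2real] density_of_cong) auto
  have \<tau>_fold: "(\<tau> m')\<^sup>2 \<le> \<tau> (fold_coloring \<sigma> N m') * \<tau> (fold_coloring \<sigma> P m')"
    if "(\<sigma>, P, N) \<in> \<F>" for m' \<sigma> P N
    unfolding \<tau>_def using folds[OF that] finite_density by (intro enn2real_density_of_fold) auto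
  have "finite L" using L finite_V finite_subset by blast
  then have card_pos: "card L > 0" using L by (simp add: card_gt_0_iff)
  have \<kappa>_pos: "\<kappa> a > 0" if "a \<in> A" for a
  proof -
    from that obtain v0 where v0: "v0 \<in> L" "a = m v0" by (auto simp: A_def)
    \<comment> \<open>A fold keeps the density positive: a positive square is bounded by a product
      of two non-negative factors, so neither vanishes. Percolation then reaches the constant
      coloring with any prescribed color of \<open>m\<close>.\<close>
    have "\<exists>m'. \<tau> m' > 0 \<and> (\<forall>v \<in> L. m' v = m v0)"
    proof (rule percolation[of "\<lambda>m'. \<tau> m' > 0"])
      show "\<tau> m > 0" using False \<tau>_nonneg[of m] unfolding \<tau>_def by linarith
      fix m' \<sigma> P N assume "\<tau> m' > 0" and fold: "(\<sigma>, P, N) \<in> \<F>"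
      then have "0 < (\<tau> m')\<^sup>2" by simp
      also note \<tau>_fold[OF fold]
      finally show "\<tau> (fold_coloring \<sigma> N m') > 0"
        using \<tau>_nonneg by (metis less_le mult_zero_left)
    qed (rule v0)
    then obtain m' where "\<tau> m' > 0" "\<forall>v \<in> L. m' v = a" using v0 by blast
    then show ?thesis using \<tau>_cong[of m' "\<lambda>_. a"] by (simp add: \<kappa>_def)
  qed
  have \<rho>_fold: "(\<rho> m')\<^sup>2 \<le> \<rho> (fold_coloring \<sigma> N m') * \<rho> (fold_coloring \<sigma> P m')"
    if fold: "(\<sigma>, P, N) \<in> \<F>" and m': "m' \<in> L \<rightarrow> A" for m' \<sigma> P N
  proof -
    have \<sigma>: "\<sigma> \<in> L \<rightarrow> L" "P \<inter> N = {}" "\<And>v. v \<in> V \<Longrightarrow> \<sigma> (\<sigma> v) = v"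
      "\<And>v. v \<in> V - P - N \<Longrightarrow> \<sigma> v = v"
      using folds[OF fold] by (auto simp: is_fold_def)
    \<comment> \<open>At each \<open>v\<close> the two folds together show the colors of
      \<open>v\<close> and \<open>\<sigma> v\<close>, in some order; for a fixed vertex these
      coincide. Since \<sigma> permutes \<open>L\<close>, the denominators multiply to the square of
      the original one.\<close>
    have "(\<Prod>v \<in> L. \<kappa> (fold_coloring \<sigma> N m' v)) * (\<Prod>v \<in> L. \<kappa> (fold_coloring \<sigma> P m' v))
        = (\<Prod>v \<in> L. \<kappa> (m' v) * \<kappa> (m' (\<sigma> v)))"
      unfolding prod.distrib[symmetric]
      using \<sigma> L by (intro prod.cong) (auto simp: fold_coloring_def)
    also have "\<dots> = (\<Prod>v \<in> L. \<kappa> (m' v)) * (\<Prod>v \<in> L. \<kappa> (m' (\<sigma> v)))"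
      by (rule prod.distrib)
    also have "(\<Prod>v \<in> L. \<kappa> (m' (\<sigma> v))) = (\<Prod>v \<in> L. \<kappa> (m' v))"
      by (rule prod.reindex_bij_witness[where i = \<sigma> and j = \<sigma>]) (use \<sigma> L in auto)
    finally have den: "(\<Prod>v \<in> L. \<kappa> (fold_coloring \<sigma> N m' v)) * (\<Prod>v \<in> L. \<kappa> (fold_coloring \<sigma> P m' v))
        = (\<Prod>v \<in> L. \<kappa> (m' v))\<^sup>2"
      by (simp add: power2_eq_square)
    show ?thesis
      using \<tau>_fold[OF fold, of m'] unfolding \<rho>_def times_divide_times_eq den power_divide
      by (rule divide_right_mono) simp
  qed
  \<comment> \<open>Colorings are total functions, so \<open>L \<rightarrow> A\<close> may be
    infinite; \<rho> sees only the values on \<open>L\<close> and thus takes finitely many values,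
    which gives the maximum.\<close>
  define S where "S = \<rho> ` {m'. m' \<in> L \<rightarrow> A}"
  have "finite S"
  proof (rule finite_subset)
    show "S \<subseteq> \<rho> ` (L \<rightarrow>\<^sub>E A)"
    proof
      fix x assume "x \<in> S"
      then obtain m' where m': "m' \<in> L \<rightarrow> A" "x = \<rho> m'" by (auto simp: S_def)
      have "\<rho> m' = \<rho> (restrict m' L)"
        unfolding \<rho>_def by (intro arg_cong2[where f = "(/)"] \<tau>_cong prod.cong) auto
      with m' show "x \<in> \<rho> ` (L \<rightarrow>\<^sub>E A)" by (intro image_eqI[of _ _ "restrict m' L"]) auto
    qed
    show "finite (\<rho> ` (L \<rightarrow>\<^sub>E A))"
      using \<open>finite L\<close> by (auto simp: A_def intro!: finite_PiE)
  qed
  define M where "M = Max S"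
  have le_M: "\<rho> m' \<le> M" if "m' \<in> L \<rightarrow> A" for m'
    unfolding M_def using that \<open>finite S\<close> by (auto simp: S_def)
  have "m \<in> L \<rightarrow> A" by (auto simp: A_def)
  then have "S \<noteq> {}" by (auto simp: S_def)
  then have "M \<in> S" unfolding M_def using \<open>finite S\<close> by (rule Max_in[rotated])
  then obtain m1 where m1: "m1 \<in> L \<rightarrow> A" "\<rho> m1 = M" by (auto simp: S_def)
  have prod_pos: "(\<Prod>v \<in> L. \<kappa> (m' v)) > 0" if "m' \<in> L \<rightarrow> A" for m'
    using that \<kappa>_pos by (intro prod_pos) auto
  have "\<rho> m > 0"
    using False \<tau>_nonneg[of m] prod_pos[OF \<open>m \<in> L \<rightarrow> A\<close>] by (auto simp: \<rho>_def \<tau>_def less_le)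
  then have "M > 0" using le_M[OF \<open>m \<in> L \<rightarrow> A\<close>] by simp
  obtain v0 where v0: "v0 \<in> L" using L by auto
  have "\<exists>m'. (m' \<in> L \<rightarrow> A \<and> \<rho> m' = M) \<and> (\<forall>v \<in> L. m' v = m1 v0)"
  proof (rule percolation)
    fix m' \<sigma> P N assume m': "m' \<in> L \<rightarrow> A \<and> \<rho> m' = M" and fold: "(\<sigma>, P, N) \<in> \<F>"
    let ?p = "fold_coloring \<sigma> N m'" and ?n = "fold_coloring \<sigma> P m'"
    have in_A: "?p \<in> L \<rightarrow> A" "?n \<in> L \<rightarrow> A"
      using m' folds[OF fold] by (auto simp: fold_coloring_def Pi_iff)
    have "M * M \<le> \<rho> ?p * \<rho> ?n"
      using \<rho>_fold[OF fold, of m'] m' by (simp add: power2_eq_square)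
    also have "\<dots> \<le> \<rho> ?p * M"
      using le_M[OF in_A(2)] \<tau>_nonneg prod_pos[OF in_A(1)]
      by (intro mult_left_mono) (auto simp: \<rho>_def intro!: divide_nonneg_nonneg)
    finally have "M \<le> \<rho> ?p" using \<open>M > 0\<close> by simp
    with le_M[OF in_A(1)] in_A show "?p \<in> L \<rightarrow> A \<and> \<rho> ?p = M" by simp
  qed (use m1 v0 in auto)
  then obtain m2 where m2: "\<rho> m2 = M" "\<forall>v \<in> L. m2 v = m1 v0" by blast
  have "\<rho> m2 = 1"
  proof -
    let ?a = "m1 v0"
    have "\<kappa> ?a > 0" using m1 v0 by (intro \<kappa>_pos) auto
    then have "\<tau> (\<lambda>_. ?a) > 0" using \<tau>_nonneg[of "\<lambda>_. ?a"] by (auto simp: \<kappa>_def less_le)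
    then have "\<kappa> ?a ^ card L = \<tau> (\<lambda>_. ?a)"
      using card_pos by (simp add: \<kappa>_def powr_realpow[symmetric] powr_powr)
    moreover have "\<tau> m2 = \<tau> (\<lambda>_. ?a)" using m2 by (intro \<tau>_cong) auto
    ultimately show ?thesis using m2 \<open>\<tau> (\<lambda>_. ?a) > 0\<close> by (simp add: \<rho>_def)
  qed
  then have "\<rho> m \<le> 1" using le_M[OF \<open>m \<in> L \<rightarrow> A\<close>] m2 by simp
  then show ?thesis
    using prod_pos[OF \<open>m \<in> L \<rightarrow> A\<close>] by (simp add: \<rho>_def \<tau>_def \<kappa>_def divide_le_eq_1)
qed

end

section \<open>Densities over a single product space\<close>

lemma measurable_coordinate: "i \<in> I \<Longrightarrow> (\<lambda>x. x i) \<in> measurable (PiM I (\<lambda>_. M)) M"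
  using measurable_component_singleton[of i I "\<lambda>_. M"] .

text \<open>Each left vertex receives a spare coordinate in \<Lambda> and each right vertex one in
  \<Omega>. The integrand ignores them and they carry total mass 1, so the integral is unchanged,
  while all vertices now share one factor space as required by
  \<open>kernel_density\<close>.\<close>

lemma hom_density_eq_nn_integral:
  fixes W :: "'c \<Rightarrow> 'x \<times> 'y \<Rightarrow> real"
  assumes G: "bigraph G" and "prob_space \<Omega>" "prob_space \<Lambda>"
    and W: "\<And>i. bigraphon \<Omega> \<Lambda> (W i)"
  shows "hom_density \<Omega> \<Lambda> G c W = enn2real (\<integral>\<^sup>+ z.
    (\<Prod>(v, w) \<in> edges G. ennreal (W (c (v, w)) (fst (z v), snd (z w))))
      \<partial>PiM (verts G) (\<lambda>_. \<Omega> \<Otimes>\<^sub>M \<Lambda>))"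
proof -
  interpret \<Omega>: prob_space \<Omega> by fact
  interpret \<Lambda>: prob_space \<Lambda> by fact
  interpret pair_prob_space \<Omega> \<Lambda> ..
  interpret product_sigma_finite "\<lambda>_ :: 'a. \<Omega> \<Otimes>\<^sub>M \<Lambda>"
    by (simp add: product_sigma_finite_def P.sigma_finite_measure_axioms)
  let ?L = "left_verts G" and ?R = "right_verts G" and ?E = "edges G" and ?\<Theta> = "\<Omega> \<Otimes>\<^sub>M \<Lambda>"
  let ?M = "PiM ?L (\<lambda>_. \<Omega>) \<Otimes>\<^sub>M PiM ?R (\<lambda>_. \<Lambda>)"
  let ?N = "PiM ?L (\<lambda>_. ?\<Theta>) \<Otimes>\<^sub>M PiM ?R (\<lambda>_. ?\<Theta>)"
  have fin: "finite ?L" "finite ?R" "?L \<inter> ?R = {}" and E: "?E \<subseteq> ?L \<times> ?R"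
    using G by (auto simp: bigraph_def)
  have W_meas [measurable]: "W i \<in> borel_measurable ?\<Theta>" for i
    using W by (auto simp: bigraphon_def)
  define h where "h p = (\<Prod>(v, w) \<in> ?E. W (c (v, w)) (fst p v, snd p w))" for p
  define H where "H p = (\<Prod>(v, w) \<in> ?E. ennreal (W (c (v, w)) (fst p v, snd p w)))" for p
  define F where "F z = (\<Prod>(v, w) \<in> ?E. ennreal (W (c (v, w)) (fst (z v), snd (z w))))" for z
  have F_meas: "F \<in> borel_measurable (PiM (verts G) (\<lambda>_. ?\<Theta>))"
    unfolding F_def
  proof (rule borel_measurable_prod_ennreal)
    fix e assume "e \<in> ?E"
    with E obtain v w where e: "e = (v, w)" "v \<in> verts G" "w \<in> verts G" by (auto simp: verts_def)
    show "(\<lambda>z. case e of (v, w) \<Rightarrow> ennreal (W (c (v, w)) (fst (z v), snd (z w))))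
        \<in> borel_measurable (PiM (verts G) (\<lambda>_. ?\<Theta>))"
      unfolding e prod.case using e
      by (intro measurable_compose[OF _ measurable_ennreal] measurable_compose[OF _ W_meas] measurable_Pair
          measurable_compose[OF measurable_coordinate measurable_fst]
          measurable_compose[OF measurable_coordinate measurable_snd])
  qed
  have factor_meas: "(\<lambda>p. W i (fst p v, snd p w)) \<in> borel_measurable ?M"
    if "(v, w) \<in> ?E" for v w i
    using that E by (intro measurable_compose[OF _ W_meas] measurable_Pair
        measurable_compose[OF measurable_fst measurable_coordinate]
        measurable_compose[OF measurable_snd measurable_coordinate]) auto
  have h_meas: "h \<in> borel_measurable ?M"
    unfolding h_def using factor_meas by (intro borel_measurable_prod) auto
  have H_meas: "H \<in> borel_measurable ?M"
    unfolding H_def using factor_meas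
    by (intro borel_measurable_prod_ennreal) (auto intro!: measurable_compose[OF _ measurable_ennreal])
  have W_nonneg: "W i (fst p v, snd p w) \<ge> 0" if "p \<in> space ?M" "(v, w) \<in> ?E" for i p v w
  proof -
    have "(fst p v, snd p w) \<in> space ?\<Theta>"
      using that E by (auto simp: space_pair_measure space_PiM PiE_def Pi_iff)
    then show ?thesis using W[of i] by (auto simp: bigraphon_def)
  qed
  have h_nonneg: "h p \<ge> 0" if "p \<in> space ?M" for p
    unfolding h_def using W_nonneg[OF that] by (intro prod_nonneg) auto
  have H_eq: "ennreal (h p) = H p" if "p \<in> space ?M" for p
    unfolding h_def H_def using W_nonneg[OF that] by (subst prod_ennreal[symmetric]) (auto intro!: prod.cong)
  have m1: "compose ?L fst \<in> measurable (PiM ?L (\<lambda>_. ?\<Theta>)) (PiM ?L (\<lambda>_. \<Omega>))"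
    unfolding compose_def
    by (intro measurable_restrict measurable_compose[OF measurable_coordinate measurable_fst])
  have m2: "compose ?R snd \<in> measurable (PiM ?R (\<lambda>_. ?\<Theta>)) (PiM ?R (\<lambda>_. \<Lambda>))"
    unfolding compose_def
    by (intro measurable_restrict measurable_compose[OF measurable_coordinate measurable_snd])
  have m12: "(\<lambda>(x, y). (compose ?L fst x, compose ?R snd y)) \<in> measurable ?N ?M"
    unfolding split_beta'
    by (intro measurable_Pair measurable_compose[OF measurable_fst m1] measurable_compose[OF measurable_snd m2])
  have "hom_density \<Omega> \<Lambda> G c W = (\<integral>p. h p \<partial>?M)"
    by (simp add: hom_density_def h_def split_beta')
  also have "\<dots> = enn2real (\<integral>\<^sup>+ p. ennreal (h p) \<partial>?M)"
    using h_meas h_nonneg by (intro integral_eq_nn_integral) (auto intro!: AE_I2)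
  also have "(\<integral>\<^sup>+ p. ennreal (h p) \<partial>?M) = (\<integral>\<^sup>+ p. H p \<partial>?M)"
    using H_eq by (rule nn_integral_cong)
  \<comment> \<open>Forgetting the spare coordinates pushes the enlarged product forward to the
    original one, since the marginals of \<Omega> \<Otimes> \<Lambda> are its factors.\<close>
  also have "?M = distr ?N ?M (\<lambda>(x, y). (compose ?L fst x, compose ?R snd y))"
  proof -
    have 1: "distr (PiM ?L (\<lambda>_. ?\<Theta>)) (PiM ?L (\<lambda>_. \<Omega>)) (compose ?L fst) = PiM ?L (\<lambda>_. \<Omega>)"
      using fin P.prob_space_axioms \<Omega>.prob_space_axioms
      by (subst distr_PiM_finite_prob_space') (auto simp: \<Lambda>.distr_pair_fst)
    have 2: "distr (PiM ?R (\<lambda>_. ?\<Theta>)) (PiM ?R (\<lambda>_. \<Lambda>)) (compose ?R snd) = PiM ?R (\<lambda>_. \<Lambda>)"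
    proof -
      have "distr ?\<Theta> \<Lambda> snd = \<Lambda>"
        by (intro measure_eqI)
          (auto simp: emeasure_distr space_pair_measure \<Lambda>.emeasure_pair_measure_Times
            \<Omega>.emeasure_space_1 snd_vimage_eq_Times Times_Int_Times sets.Int_space_eq2[symmetric]
            Int_absorb2 sets.sets_into_space)
      then show ?thesis
        using fin P.prob_space_axioms \<Lambda>.prob_space_axioms
        by (subst distr_PiM_finite_prob_space') auto
    qed
    have "prob_space (PiM ?R (\<lambda>_. \<Lambda>))" using \<Lambda>.prob_space_axioms by (intro prob_space_PiM)
    then interpret PR: prob_space "PiM ?R (\<lambda>_. \<Lambda>)" .
    show ?thesis
      using pair_measure_distr[OF m1 m2] unfolding 1 2 by (simp add: PR.sigma_finite_measure_axioms)
  qed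
  also have "(\<integral>\<^sup>+ p. H p \<partial>distr ?N ?M (\<lambda>(x, y). (compose ?L fst x, compose ?R snd y))) =
      (\<integral>\<^sup>+ p. H (compose ?L fst (fst p), compose ?R snd (snd p)) \<partial>?N)"
    by (subst nn_integral_distr[OF m12]) (simp_all add: H_meas split_beta')
  also have "\<dots> = (\<integral>\<^sup>+ p. F (merge ?L ?R p) \<partial>?N)"
  proof (rule nn_integral_cong)
    fix p
    show "H (compose ?L fst (fst p), compose ?R snd (snd p)) = F (merge ?L ?R p)"
      unfolding H_def F_def
    proof (intro prod.cong refl)
      fix e assume "e \<in> ?E"
      with E obtain v w where e: "e = (v, w)" "v \<in> ?L" "w \<in> ?R" by auto
      then have "w \<notin> ?L" using fin by auto
      with e show "(case e of (v, w) \<Rightarrow> ennreal (W (c (v, w))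
            (fst (compose ?L fst (fst p), compose ?R snd (snd p)) v,
             snd (compose ?L fst (fst p), compose ?R snd (snd p)) w))) =
          (case e of (v, w) \<Rightarrow> ennreal (W (c (v, w)) (fst (merge ?L ?R p v), snd (merge ?L ?R p w))))"
        by (simp add: compose_def merge_def split_beta')
    qed
  qed
  also have "\<dots> = (\<integral>\<^sup>+ z. F z \<partial>distr ?N (PiM (verts G) (\<lambda>_. ?\<Theta>)) (merge ?L ?R))"
    by (rule nn_integral_distr[symmetric]) (use F_meas in \<open>simp_all add: verts_def measurable_merge\<close>)
  also have "distr ?N (PiM (verts G) (\<lambda>_. ?\<Theta>)) (merge ?L ?R) = PiM (verts G) (\<lambda>_. ?\<Theta>)"
    unfolding verts_def by (rule distr_merge) (use fin in auto)
  finally show ?thesis unfolding F_def .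
qed

text \<open>Separates analysis from combinatorics: for a concrete bigraph only a family of folds and
  its percolation property have to be supplied, and neither mentions a measure.\<close>

lemma left_weakly_Hoelder_percolation:
  fixes G :: "'v bigraph" and c :: "'v \<times> 'v \<Rightarrow> 'c"
  assumes G: "colored_bigraph G C c" "left_verts G \<noteq> {}"
    and folds: "\<And>\<sigma> P N. (\<sigma>, P, N) \<in> \<F> \<Longrightarrow>
      is_fold (verts G) (edges G) c \<sigma> P N \<and> \<sigma> \<in> left_verts G \<rightarrow> left_verts G"
    and percolation: "\<And>Q (m :: 'v \<Rightarrow> 'l) v0. Q m \<Longrightarrow> v0 \<in> left_verts G \<Longrightarrow>
      (\<And>m' \<sigma> P N. Q m' \<Longrightarrow> (\<sigma>, P, N) \<in> \<F> \<Longrightarrow> Q (fold_coloring \<sigma> N m')) \<Longrightarrow>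
      \<exists>m'. Q m' \<and> (\<forall>v \<in> left_verts G. m' v = m v0)"
  shows "left_weakly_Hoelder TYPE('l) TYPE('x) TYPE('y) G C c"
  unfolding left_weakly_Hoelder_def
proof (intro allI impI)
  fix C' and m :: "'v \<Rightarrow> 'l" and \<Omega> :: "'x measure" and \<Lambda> :: "'y measure" and W
  assume m: "m \<in> left_verts G \<rightarrow> C'" and prob: "prob_space \<Omega>" "prob_space \<Lambda>"
    and W: "\<forall>i \<in> C' \<times> C. bigraphon \<Omega> \<Lambda> (W i)"
  let ?L = "left_verts G" and ?V = "verts G" and ?E = "edges G" and ?\<Theta> = "\<Omega> \<Otimes>\<^sub>M \<Lambda>"
  have bigraph: "bigraph G" and c: "c \<in> ?E \<rightarrow> C" using G by (auto simp: colored_bigraph_def)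
  have fin: "finite ?V" and E: "?E \<subseteq> ?L \<times> ?V" and L: "?L \<subseteq> ?V"
    using bigraph by (auto simp: bigraph_def verts_def)
  \<comment> \<open>The hypothesis speaks only of colors in \<open>C' \<times> C\<close>, whereas
    the kernels must be measurable for every color. The default 0 is never read, because the left
    colors of \<open>m'\<close> lie in \<open>C'\<close> and the edge colors in
    \<open>C\<close>.\<close>
  define W' where "W' i = (if i \<in> C' \<times> C then W i else (\<lambda>_. 0))" for i
  have W': "bigraphon \<Omega> \<Lambda> (W' i)" for i
    using W by (auto simp: W'_def bigraphon_def)
  have hom_W': "hom_density \<Omega> \<Lambda> G (left_color_tensor m' c) W = hom_density \<Omega> \<Lambda> G (left_color_tensor m' c) W'"
    if "m' \<in> ?L \<rightarrow> C'" for m'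
  proof -
    have "W (left_color_tensor m' c (v, w)) = W' (left_color_tensor m' c (v, w))" if "(v, w) \<in> ?E" for v w
      using that \<open>m' \<in> ?L \<rightarrow> C'\<close> c E by (auto simp: W'_def left_color_tensor_def Pi_iff)
    then have "(\<Prod>(v, w) \<in> ?E. W (left_color_tensor m' c (v, w)) (x v, y w)) =
        (\<Prod>(v, w) \<in> ?E. W' (left_color_tensor m' c (v, w)) (x v, y w))" for x y
      by (intro prod.cong refl) auto
    then show ?thesis unfolding hom_density_def by simp
  qed
  interpret \<Omega>: prob_space \<Omega> by fact
  interpret \<Lambda>: prob_space \<Lambda> by fact
  interpret pair_prob_space \<Omega> \<Lambda> ..
  define K where "K a i z z' = ennreal (W' (a, i) (fst z, snd z'))"
    for a i and z z' :: "'x \<times> 'y"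
  interpret kernel_density ?\<Theta> ?V ?E c K
  proof
    show "finite ?V" "?E \<subseteq> ?V \<times> ?V" using fin E L by auto
    fix a i
    have "W' (a, i) \<in> borel_measurable ?\<Theta>" using W' by (auto simp: bigraphon_def)
    then show "(\<lambda>(z, z'). K a i z z') \<in> borel_measurable (?\<Theta> \<Otimes>\<^sub>M ?\<Theta>)"
      unfolding K_def split_beta'
      by (intro measurable_compose[OF _ measurable_ennreal]
          measurable_compose[of "\<lambda>p. (fst (fst p), snd (snd p))" _ ?\<Theta> "W' (a, i)"]) auto
  qed
  have hom: "hom_density \<Omega> \<Lambda> G (left_color_tensor m' c) W' = enn2real (density_of m')" for m'
    unfolding density_of_def kernel_prod_def unfolding K_def
    by (subst hom_density_eq_nn_integral[OF bigraph prob W']) (simp add: left_color_tensor_def)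
  have finite_density: "density_of m' < \<infinity>" for m'
  proof -
    have "\<exists>B. \<forall>p \<in> space ?\<Theta>. W' i p \<le> B" for i using W'[of i] by (auto simp: bigraphon_def)
    then obtain B where B: "\<And>i p. p \<in> space ?\<Theta> \<Longrightarrow> W' i p \<le> B i" by metis
    let ?b = "\<Prod>(v, w) \<in> ?E. ennreal (B (m' v, c (v, w)))"
    interpret PV: prob_space "PiM ?V (\<lambda>_. ?\<Theta>)"
      by (intro prob_space_PiM P.prob_space_axioms)
    have "density_of m' \<le> (\<integral>\<^sup>+ z. ?b \<partial>PiM ?V (\<lambda>_. ?\<Theta>))"
      unfolding density_of_def
    proof (rule nn_integral_mono)
      fix z assume z: "z \<in> space (PiM ?V (\<lambda>_. ?\<Theta>))"
      have "(fst (z v), snd (z w)) \<in> space ?\<Theta>" if "(v, w) \<in> ?E" for v w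
      proof -
        have "z v \<in> space ?\<Theta>" "z w \<in> space ?\<Theta>"
          using that E L z by (auto simp: space_PiM PiE_def Pi_iff)
        then show ?thesis by (auto simp: space_pair_measure)
      qed
      then show "kernel_prod ?E m' z \<le> ?b"
        unfolding kernel_prod_def unfolding K_def by (intro prod_mono_ennreal) (auto intro!: ennreal_leI B)
    qed
    also have "\<dots> = ?b" by (simp add: PV.emeasure_space_1)
    also have "\<dots> < \<infinity>" by (simp add: less_top[symmetric] ennreal_prod_eq_top split_beta')
    finally show ?thesis .
  qed
  have "enn2real (density_of m) \<le> (\<Prod>v \<in> ?L. enn2real (density_of (\<lambda>_. m v)) powr (1 / real (card ?L)))"
    by (rule percolation_imp_Hoelder[where \<F> = \<F>])
      (use G(2) E L finite_density folds percolation in auto)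
  moreover have "(\<lambda>_. m v) \<in> ?L \<rightarrow> C'" if "v \<in> ?L" for v using m that by auto
  ultimately show "hom_density \<Omega> \<Lambda> G (left_color_tensor m c) W \<le>
      (\<Prod>v \<in> ?L. hom_density \<Omega> \<Lambda> G (left_color_tensor (\<lambda>_. m v) c) W powr (1 / real (card ?L)))"
    using m by (simp add: hom_W' hom cong: prod.cong)
qed

section \<open>Roots and words in simple reflections\<close>

lemma GL_sel [simp]:
  "carrier GL = {A. invertible A}" "A \<otimes>\<^bsub>GL\<^esub> B = A ** B" "\<one>\<^bsub>GL\<^esub> = mat 1"
  by (simp_all add: GL_def)

lemma invertible_mat_1: "invertible (mat 1 :: real^'n^'n)"
  unfolding invertible_def by (intro exI[of _ "mat 1"]) simp

lemma group_GL: "group (GL :: (real^'n^'n) monoid)"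
proof (rule groupI)
  fix A assume "A \<in> carrier (GL :: (real^'n^'n) monoid)"
  then obtain B where "A ** B = mat 1" "B ** A = mat 1"
    by (auto simp: invertible_def)
  then show "\<exists>B \<in> carrier GL. B \<otimes>\<^bsub>GL\<^esub> A = \<one>\<^bsub>GL\<^esub>"
    by (intro bexI[of _ B]) (auto simp: invertible_def)
qed (auto simp: matrix_mul_assoc invertible_mat_1 intro: invertible_mult)

section \<open>Reflections as orthogonal matrices, and their roots\<close>

lemma reflection_mult: "reflection \<alpha> *v x = x - (2 * (x \<bullet> \<alpha>) / (\<alpha> \<bullet> \<alpha>)) *\<^sub>R \<alpha>"
proof -
  have "linear (\<lambda>x. x - (2 * (x \<bullet> \<alpha>) / (\<alpha> \<bullet> \<alpha>)) *\<^sub>R \<alpha>)"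
    by (rule linearI) (auto simp: algebra_simps inner_add_left add_divide_distrib)
  then show ?thesis
    unfolding reflection_def by (simp add: matrix_works)
qed

lemma reflection_self: "reflection \<alpha> *v \<alpha> = - \<alpha>"
  by (cases "\<alpha> = 0") (auto simp: reflection_mult scaleR_2)

lemma reflection_involution: "reflection \<alpha> *v (reflection \<alpha> *v x) = x"
  by (cases "\<alpha> = 0") (auto simp: reflection_mult inner_diff_left diff_divide_distrib
      right_diff_distrib scaleR_diff_left)

lemma reflection_square: "reflection \<alpha> ** reflection \<alpha> = mat 1"
  by (simp add: matrix_eq reflection_involution flip: matrix_vector_mul_assoc)

lemma orthogonal_matrix_iff_inner:
  fixes A :: "real^'n^'n"
  shows "orthogonal_matrix A \<longleftrightarrow> (\<forall>x y. (A *v x) \<bullet> (A *v y) = x \<bullet> y)"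
  using orthogonal_transformation_matrix[of "(*v) A"]
  by (simp add: orthogonal_transformation_def)

lemma inner_reflection: "(reflection \<alpha> *v x) \<bullet> y = x \<bullet> (reflection \<alpha> *v y)"
  by (simp add: reflection_mult inner_diff_left inner_diff_right inner_commute)

lemma orthogonal_matrix_reflection: "orthogonal_matrix (reflection \<alpha>)"
  unfolding orthogonal_matrix_iff_inner by (simp add: inner_reflection reflection_involution)

lemma invertible_reflection: "invertible (reflection \<alpha>)"
  using reflection_square by (auto simp: invertible_def)

lemma inv_reflection: "inv\<^bsub>GL\<^esub> (reflection \<alpha>) = reflection \<alpha>"
  by (rule group.inv_equality[OF group_GL])
    (simp_all add: reflection_square invertible_reflection)

lemma transpose_reflection: "transpose (reflection \<alpha>) = reflection \<alpha>"
proof -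
  have "transpose (reflection \<alpha>) ** (reflection \<alpha> ** reflection \<alpha>) = reflection \<alpha>"
    unfolding matrix_mul_assoc using orthogonal_matrix_reflection[of \<alpha>]
    by (simp add: orthogonal_matrix)
  then show ?thesis by (simp add: reflection_square)
qed

lemma reflection_conj:
  assumes "orthogonal_matrix A"
  shows "reflection (A *v \<alpha>) ** A = A ** reflection \<alpha>"
  using assms unfolding orthogonal_matrix_iff_inner
  by (simp add: matrix_eq reflection_mult matrix_vector_mult_diff_distrib
      matrix_vector_mult_scaleR flip: matrix_vector_mul_assoc)

lemma reflection_scaleR: "k \<noteq> 0 \<Longrightarrow> reflection (k *\<^sub>R \<alpha>) = reflection \<alpha>"
  by (simp add: matrix_eq reflection_mult)

lemma reflection_minus: "reflection (- \<alpha>) = reflection \<alpha>"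
  using reflection_scaleR[of "-1" \<alpha>] by simp

text \<open>Evaluating both reflections at \<alpha> shows that \<alpha> is a multiple of \<beta>. A
  reflection thus has only two unit normals, whence the finiteness of the root system.\<close>

lemma reflection_eq_unit:
  assumes "norm \<alpha> = 1" "norm \<beta> = 1" "reflection \<alpha> = reflection \<beta>"
  shows "\<alpha> = \<beta> \<or> \<alpha> = - \<beta>"
proof -
  have "- \<alpha> = \<alpha> - (2 * (\<alpha> \<bullet> \<beta>)) *\<^sub>R \<beta>"
    using reflection_self[of \<alpha>] assms by (simp add: reflection_mult dot_square_norm)
  then have "2 *\<^sub>R \<alpha> = 2 *\<^sub>R ((\<alpha> \<bullet> \<beta>) *\<^sub>R \<beta>)" by (simp add: scaleR_2 algebra_simps)
  then have eq: "\<alpha> = (\<alpha> \<bullet> \<beta>) *\<^sub>R \<beta>" by (simp only: scaleR_cancel_left) simp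
  then have "norm \<alpha> = norm ((\<alpha> \<bullet> \<beta>) *\<^sub>R \<beta>)" by (rule arg_cong)
  then have "\<bar>\<alpha> \<bullet> \<beta>\<bar> = 1" using assms by simp
  then have "\<alpha> \<bullet> \<beta> = 1 \<or> \<alpha> \<bullet> \<beta> = -1" by linarith
  then show ?thesis
  proof
    assume "\<alpha> \<bullet> \<beta> = 1"
    with eq have "\<alpha> = 1 *\<^sub>R \<beta>" by (simp only:)
    then show ?thesis by simp
  next
    assume "\<alpha> \<bullet> \<beta> = -1"
    with eq have "\<alpha> = (-1) *\<^sub>R \<beta>" by (simp only:)
    then show ?thesis by simp
  qed
qed

lemma matrix_vector_mult_minus: "A *v (- x) = - (A *v x)" for A :: "real^'n^'m"
  using matrix_vector_mult_diff_distrib[of A 0 x] by simp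

text \<open>By dimension, the hyperplane \<open>H\<close> is the whole orthogonal complement of the
  root and also of the vector defining the reflection, so the two vectors are parallel.\<close>

lemma root_system_iff:
  fixes R :: "(real^'n^'n) set"
  shows "\<alpha> \<in> root_system R \<longleftrightarrow> norm \<alpha> = 1 \<and> reflection \<alpha> \<in> R"
proof
  assume "\<alpha> \<in> root_system R"
  then obtain \<beta> H where \<alpha>: "norm \<alpha> = 1" and \<beta>: "\<beta> \<noteq> 0" "reflection \<beta> \<in> R"
    and H: "subspace H" "dim H = CARD('n) - 1" "\<forall>x \<in> H. reflection \<beta> *v x = x"
      "\<forall>x \<in> H. orthogonal \<alpha> x"
    unfolding root_system_def is_reflection_def by auto
  have sub: "H \<subseteq> {x. \<gamma> \<bullet> x = 0} \<Longrightarrow> \<gamma> \<noteq> 0 \<Longrightarrow> H = {x. \<gamma> \<bullet> x = 0}" for \<gamma>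
    using H dim_hyperplane[of \<gamma>] subspace_hyperplane[of \<gamma>]
    by (intro subspace_dim_equal) auto
  have "H = {x. \<alpha> \<bullet> x = 0}"
    using H \<alpha> by (intro sub) (auto simp: orthogonal_def)
  moreover have "H = {x. \<beta> \<bullet> x = 0}"
    using H(3) \<beta> by (intro sub) (auto simp: reflection_mult inner_commute)
  ultimately have eq: "\<alpha> \<bullet> x = 0 \<longleftrightarrow> \<beta> \<bullet> x = 0" for x by auto
  \<comment> \<open>The component of \<alpha> orthogonal to \<beta> is also orthogonal to \<alpha>,
    as both vectors have the same orthogonal complement. It is then orthogonal to itself and
    vanishes.\<close>
  have "\<beta> \<bullet> (\<alpha> - ((\<alpha> \<bullet> \<beta>) / (\<beta> \<bullet> \<beta>)) *\<^sub>R \<beta>) = 0"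
    using \<beta> by (simp add: inner_diff_right inner_commute)
  then have "\<alpha> \<bullet> (\<alpha> - ((\<alpha> \<bullet> \<beta>) / (\<beta> \<bullet> \<beta>)) *\<^sub>R \<beta>) = 0" using eq by blast
  moreover note \<open>\<beta> \<bullet> (\<alpha> - ((\<alpha> \<bullet> \<beta>) / (\<beta> \<bullet> \<beta>)) *\<^sub>R \<beta>) = 0\<close>
  ultimately have "(\<alpha> - ((\<alpha> \<bullet> \<beta>) / (\<beta> \<bullet> \<beta>)) *\<^sub>R \<beta>) \<bullet> (\<alpha> - ((\<alpha> \<bullet> \<beta>) / (\<beta> \<bullet> \<beta>)) *\<^sub>R \<beta>) = 0"
    by (simp add: inner_diff_left)
  then obtain k where k: "\<alpha> = k *\<^sub>R \<beta>" by (metis eq_iff_diff_eq_0 inner_eq_zero_iff)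
  then have "k \<noteq> 0" using \<alpha> by auto
  then have "reflection \<alpha> = reflection \<beta>" unfolding k by (rule reflection_scaleR)
  then show "norm \<alpha> = 1 \<and> reflection \<alpha> \<in> R" using \<alpha> \<beta> by simp
next
  assume *: "norm \<alpha> = 1 \<and> reflection \<alpha> \<in> R"
  then have "\<alpha> \<noteq> 0" by auto
  let ?H = "{x. \<alpha> \<bullet> x = 0}"
  have "subspace ?H" "dim ?H = CARD('n) - 1"
    using subspace_hyperplane[of \<alpha>] dim_hyperplane[OF \<open>\<alpha> \<noteq> 0\<close>] by simp_all
  moreover have "\<forall>x \<in> ?H. reflection \<alpha> *v x = x" "\<forall>x \<in> ?H. orthogonal \<alpha> x"
    by (simp_all add: reflection_mult inner_commute orthogonal_def)
  moreover have "is_reflection (reflection \<alpha>)"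
    using \<open>\<alpha> \<noteq> 0\<close> unfolding is_reflection_def by blast
  ultimately show "\<alpha> \<in> root_system R"
    using * unfolding root_system_def by blast
qed

section \<open>Lexicographic positivity\<close>

text \<open>Detached from \<open>positive_roots\<close> so that it also applies to sums and
  multiples of roots, which are in general not roots.\<close>

definition lex_positive :: "'a::real_vector list \<Rightarrow> 'a \<Rightarrow> bool" where
  "lex_positive us v \<longleftrightarrow> (\<exists>c. v = (\<Sum>i<length us. c i *\<^sub>R us ! i) \<and>
     (\<exists>i0<length us. c i0 > 0 \<and> (\<forall>i<i0. c i = 0)))"

text \<open>The leading index of the sum is the smaller of the two leading indices; if they agree,
  two positive coefficients add up and cannot cancel.\<close>

lemma lex_positive_add:
  assumes "lex_positive us v" "lex_positive us w"
  shows "lex_positive us (v + w)"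
proof -
  from assms obtain c i d j where
    c: "v = (\<Sum>i<length us. c i *\<^sub>R us ! i)" "i < length us" "c i > (0::real)" "\<forall>i'<i. c i' = 0" and
    d: "w = (\<Sum>i<length us. d i *\<^sub>R us ! i)" "j < length us" "d j > (0::real)" "\<forall>j'<j. d j' = 0"
    unfolding lex_positive_def by blast
  have "c (min i j) + d (min i j) > 0"
    using c d by (cases i j rule: linorder_cases) (auto simp: min_def)
  moreover have "v + w = (\<Sum>i<length us. (c i + d i) *\<^sub>R us ! i)"
    using c d by (simp add: scaleR_add_left sum.distrib)
  ultimately show ?thesis
    unfolding lex_positive_def using c d
    by (intro exI[of _ "\<lambda>i. c i + d i"] conjI exI[of _ "min i j"]) auto
qed

lemma lex_positive_scaleR:
  assumes "lex_positive us v" "k > 0"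
  shows "lex_positive us (k *\<^sub>R v)"
proof -
  from assms obtain c i where
    c: "v = (\<Sum>i<length us. c i *\<^sub>R us ! i)" "i < length us" "c i > 0" "\<forall>i'<i. c i' = 0"
    unfolding lex_positive_def by blast
  then show ?thesis
    unfolding lex_positive_def using assms
    by (intro exI[of _ "\<lambda>i. k * c i"] conjI exI[of _ i]) (auto simp: scaleR_sum_right)
qed

lemma not_lex_positive_0:
  assumes "distinct us" "independent (set us)"
  shows "\<not> lex_positive us 0"
proof
  assume "lex_positive us 0"
  then obtain c i where
    c: "(\<Sum>i<length us. c i *\<^sub>R us ! i) = 0" "i < length us" "c i > 0"
    unfolding lex_positive_def by metis
  have bij: "bij_betw ((!) us) {..<length us} (set us)"
    using assms by (intro bij_betw_nth) auto
  \<comment> \<open>Coefficients indexed by list position become coefficients indexed by basis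
    vectors, the form in which linear independence applies.\<close>
  define g where "g u = c (the_inv_into {..<length us} ((!) us) u)" for u
  have g: "g (us ! j) = c j" if "j < length us" for j
    unfolding g_def using that bij by (simp add: bij_betw_def the_inv_into_f_f)
  have "(\<Sum>u\<in>set us. g u *\<^sub>R u) = (\<Sum>j<length us. g (us ! j) *\<^sub>R us ! j)"
    by (rule sum.reindex_bij_betw[OF bij, symmetric])
  also have "\<dots> = 0" using c g by simp
  finally have "g (us ! i) = 0"
    using assms c by (intro independentD[of "set us"]) auto
  then show False using g c by simp
qed

lemma lex_positive_cases:
  assumes "distinct us" "span (set us) = UNIV" "v \<noteq> 0"
  shows "lex_positive us v \<or> lex_positive us (- v)"
proof -
  have "v \<in> span (set us)" using assms by simp
  then obtain g where "v = (\<Sum>u\<in>set us. g u *\<^sub>R u)"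
    by (auto simp: span_finite)
  also have "\<dots> = (\<Sum>j<length us. g (us ! j) *\<^sub>R us ! j)"
    using assms by (intro sum.reindex_bij_betw[symmetric] bij_betw_nth) auto
  finally have v: "v = (\<Sum>j<length us. g (us ! j) *\<^sub>R us ! j)" .
  define i where "i = (LEAST j. j < length us \<and> g (us ! j) \<noteq> 0)"
  have "\<exists>j. j < length us \<and> g (us ! j) \<noteq> 0"
    using assms(3) v by (metis (no_types, lifting) lessThan_iff scaleR_zero_left sum.neutral)
  then have i: "i < length us \<and> g (us ! i) \<noteq> 0" unfolding i_def by (rule LeastI_ex)
  have below: "g (us ! j) = 0" if "j < i" for j
    using that i not_less_Least[of j "\<lambda>j. j < length us \<and> g (us ! j) \<noteq> 0"] unfolding i_def by simp
  show ?thesis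
  proof (cases "g (us ! i) > 0")
    case True
    then have "lex_positive us v"
      unfolding lex_positive_def using v i below by (intro exI[of _ "\<lambda>j. g (us ! j)"]) auto
    then show ?thesis ..
  next
    case False
    then have "lex_positive us (- v)"
      unfolding lex_positive_def using v i below
      by (intro exI[of _ "\<lambda>j. - g (us ! j)"] conjI exI[of _ i]) (auto simp: sum_negf)
    then show ?thesis ..
  qed
qed

lemma lex_positive_sum:
  assumes "finite D" "\<And>d. d \<in> D \<Longrightarrow> lex_positive us d" "\<And>d. d \<in> D \<Longrightarrow> c d \<ge> 0"
    and "\<exists>d \<in> D. c d \<noteq> 0"
  shows "lex_positive us (\<Sum>d\<in>D. c d *\<^sub>R d)"
  using assms
proof (induction D rule: finite_induct)
  case (insert a D)
  show ?case
  proof (cases "\<exists>d \<in> D. c d \<noteq> 0")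
    case True
    then have IH: "lex_positive us (\<Sum>d\<in>D. c d *\<^sub>R d)" using insert by auto
    show ?thesis
    proof (cases "c a = 0")
      case False
      then have "lex_positive us (c a *\<^sub>R a)"
        using insert.prems by (intro lex_positive_scaleR) (auto simp: less_le)
      then show ?thesis using IH insert by (simp add: lex_positive_add)
    qed (use IH insert in simp)
  next
    case False
    then have "c a \<noteq> 0" "(\<Sum>d\<in>D. c d *\<^sub>R d) = 0" using insert.prems by auto
    moreover have "lex_positive us (c a *\<^sub>R a)"
      using insert.prems \<open>c a \<noteq> 0\<close> by (intro lex_positive_scaleR) (auto simp: less_le)
    ultimately show ?thesis using insert by simp
  qed
qed auto

section \<open>Positive roots and the simple system\<close>

locale reflection_group =
  fixes R :: "(real^'n^'n) set" and us :: "(real^'n) list" and \<Delta> :: "(real^'n) set"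
  assumes finite_reflection_group: "finite_reflection_group R"
    and ordered_basis: "ordered_basis us"
    and simple_system: "simple_system R us \<Delta>"
begin

abbreviation Pos :: "(real^'n) set" where "Pos \<equiv> positive_roots R us"

lemma subgroup_R: "subgroup R GL" and finite_R: "finite R"
  using finite_reflection_group by (auto simp: finite_reflection_group_def)

lemma R_closed:
  shows one_in_R: "mat 1 \<in> R"
    and mult_in_R: "A \<in> R \<Longrightarrow> B \<in> R \<Longrightarrow> A ** B \<in> R"
    and inv_in_R: "A \<in> R \<Longrightarrow> inv\<^bsub>GL\<^esub> A \<in> R"
  using subgroup.one_closed[OF subgroup_R] subgroup.m_closed[OF subgroup_R]
    subgroup.m_inv_closed[OF subgroup_R] by simp_all

lemma orthogonal_R:
  assumes "A \<in> R"
  shows "orthogonal_matrix A"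
proof -
  obtain T where T: "\<forall>t \<in> T. is_reflection t" "R = generate GL T"
    using finite_reflection_group by (auto simp: finite_reflection_group_def)
  have "A \<in> generate GL T" using assms T by simp
  then show ?thesis
  proof (induction rule: generate.induct)
    case one
    then show ?case by (simp add: orthogonal_matrix_id)
  next
    case (incl h)
    then show ?case using T by (auto simp: is_reflection_def orthogonal_matrix_reflection)
  next
    case (inv h)
    then show ?case
      using T by (auto simp: is_reflection_def inv_reflection orthogonal_matrix_reflection)
  next
    case (eng h1 h2)
    then show ?case by (simp add: orthogonal_matrix_mul)
  qed
qed

lemma inv_eq_transpose:
  assumes "A \<in> R"
  shows "inv\<^bsub>GL\<^esub> A = transpose A"
proof (rule group.inv_equality[OF group_GL])
  show "transpose A \<otimes>\<^bsub>GL\<^esub> A = \<one>\<^bsub>GL\<^esub>"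
    using orthogonal_R[OF assms] by (simp add: orthogonal_matrix_def)
  show "A \<in> carrier GL" "transpose A \<in> carrier GL"
    using orthogonal_R[OF assms] by (auto simp: orthogonal_matrix_def invertible_def)
qed

lemma transpose_in_R: "A \<in> R \<Longrightarrow> transpose A \<in> R"
  using inv_in_R inv_eq_transpose by metis

lemma transpose_mult_R: "A \<in> R \<Longrightarrow> transpose A ** A = mat 1" "A \<in> R \<Longrightarrow> A ** transpose A = mat 1"
  using orthogonal_R by (simp_all add: orthogonal_matrix_def)

lemma reflection_conj_R:
  assumes "A \<in> R"
  shows "reflection (A *v \<alpha>) = A ** reflection \<alpha> ** transpose A"
proof -
  have "reflection (A *v \<alpha>) ** (A ** transpose A) = A ** reflection \<alpha> ** transpose A"
    using reflection_conj[OF orthogonal_R[OF assms], of \<alpha>] by (simp add: matrix_mul_assoc)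
  then show ?thesis using assms by (simp add: transpose_mult_R)
qed

lemma root_mult:
  assumes "A \<in> R" "\<alpha> \<in> root_system R"
  shows "A *v \<alpha> \<in> root_system R"
  using assms orthogonal_R[OF assms(1)]
  by (auto simp: root_system_iff reflection_conj_R norm_eq_sqrt_inner orthogonal_matrix_iff_inner
      intro!: mult_in_R transpose_in_R)

lemma finite_root_system: "finite (root_system R)"
proof (rule finite_subset)
  show "root_system R \<subseteq> (\<Union>t \<in> R. {\<alpha>. norm \<alpha> = 1 \<and> reflection \<alpha> = t})"
    by (auto simp: root_system_iff)
  have "finite {\<alpha>. norm \<alpha> = 1 \<and> reflection \<alpha> = t}" for t :: "real^'n^'n"
  proof (cases "\<exists>\<beta>. norm \<beta> = 1 \<and> reflection \<beta> = t")
    case True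
    then obtain \<beta> where "norm \<beta> = 1" "reflection \<beta> = t" by blast
    then have "{\<alpha>. norm \<alpha> = 1 \<and> reflection \<alpha> = t} \<subseteq> {\<beta>, - \<beta>}"
      by (auto dest: reflection_eq_unit)
    then show ?thesis by (rule finite_subset) simp
  qed (simp add: Collect_empty_eq[THEN iffD2])
  then show "finite (\<Union>t \<in> R. {\<alpha>. norm \<alpha> = 1 \<and> reflection \<alpha> = t})"
    using finite_R by blast
qed

lemma Pos_iff: "\<alpha> \<in> Pos \<longleftrightarrow> \<alpha> \<in> root_system R \<and> lex_positive us \<alpha>"
  by (auto simp: positive_roots_def lex_positive_def)

lemma finite_Pos: "finite Pos"
  using finite_root_system by (rule rev_finite_subset) (auto simp: Pos_iff)

lemma not_lex_positive_0': "\<not> lex_positive us 0"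
  using not_lex_positive_0 ordered_basis by (auto simp: ordered_basis_def)

lemma not_both_Pos: "\<alpha> \<in> Pos \<Longrightarrow> - \<alpha> \<notin> Pos"
  using lex_positive_add[of us \<alpha> "- \<alpha>"] not_lex_positive_0' by (auto simp: Pos_iff)

lemma root_minus: "\<alpha> \<in> root_system R \<Longrightarrow> - \<alpha> \<in> root_system R"
  by (simp add: root_system_iff reflection_minus)

lemma Pos_cases: "\<alpha> \<in> root_system R \<Longrightarrow> \<alpha> \<in> Pos \<or> - \<alpha> \<in> Pos"
  using lex_positive_cases[of us \<alpha>] ordered_basis root_minus[of \<alpha>]
  by (cases "\<alpha> = 0") (auto simp: Pos_iff ordered_basis_def root_system_iff)

lemma simple_Pos: "\<Delta> \<subseteq> Pos"
  using simple_system by (simp add: simple_system_def)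

lemma finite_simple: "finite \<Delta>"
  using simple_Pos finite_Pos finite_subset by blast

lemma Pos_root: "\<alpha> \<in> Pos \<Longrightarrow> \<alpha> \<in> root_system R"
  by (simp add: Pos_iff)

lemma reflection_in_R: "\<alpha> \<in> root_system R \<Longrightarrow> reflection \<alpha> \<in> R"
  by (simp add: root_system_iff)

lemma Pos_nonneg_combination:
  assumes "\<alpha> \<in> Pos"
  obtains c where "\<And>\<delta>. \<delta> \<in> \<Delta> \<Longrightarrow> c \<delta> \<ge> 0" "\<alpha> = (\<Sum>\<delta>\<in>\<Delta>. c \<delta> *\<^sub>R \<delta>)"
proof -
  have "nonneg_generates \<Delta> Pos" using simple_system by (simp add: simple_system_def)
  then obtain c where "\<forall>\<delta> \<in> \<Delta>. 0 \<le> c \<delta>" "\<alpha> = (\<Sum>\<delta>\<in>\<Delta>. c \<delta> *\<^sub>R \<delta>)"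
    using assms unfolding nonneg_generates_def by metis
  then show ?thesis by (intro that) auto
qed

text \<open>Minimality of the simple system enters through the fact that no simple root is a non-negative
  combination of the other ones.\<close>

lemma simple_reflection_permutes:
  assumes \<delta>: "\<delta> \<in> \<Delta>" and \<gamma>: "\<gamma> \<in> Pos" "\<gamma> \<noteq> \<delta>"
  shows "reflection \<delta> *v \<gamma> \<in> Pos"
proof (rule ccontr)
  assume neg: "reflection \<delta> *v \<gamma> \<notin> Pos"
  have "reflection \<delta> *v \<gamma> \<in> root_system R"
    using \<delta> \<gamma> simple_Pos by (intro root_mult reflection_in_R Pos_root) auto
  then have \<eta>: "- (reflection \<delta> *v \<gamma>) \<in> Pos" using neg Pos_cases by blast
  obtain a where a: "\<And>d. d \<in> \<Delta> \<Longrightarrow> a d \<ge> 0" "\<gamma> = (\<Sum>d\<in>\<Delta>. a d *\<^sub>R d)"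
    using Pos_nonneg_combination[OF \<gamma>(1)] by metis
  obtain b where b: "\<And>d. d \<in> \<Delta> \<Longrightarrow> b d \<ge> 0" "- (reflection \<delta> *v \<gamma>) = (\<Sum>d\<in>\<Delta>. b d *\<^sub>R d)"
    using Pos_nonneg_combination[OF \<eta>] by metis
  define e where "e d = a d + b d" for d
  define k where "k = 2 * (\<gamma> \<bullet> \<delta>) / (\<delta> \<bullet> \<delta>)"
  define D where "D = \<Delta> - {\<delta>}"
  have D: "\<Delta> = insert \<delta> D" "\<delta> \<notin> D" "finite D" "D \<subset> \<Delta>"
    using \<delta> finite_simple by (auto simp: D_def)
  \<comment> \<open>\<gamma> and its reflection differ by a multiple of \<delta>. If the reflected
    root were negative, that multiple would be a sum of two non-negative combinations of simple
    roots.\<close>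
  have "k *\<^sub>R \<delta> = \<gamma> + - (reflection \<delta> *v \<gamma>)" by (simp add: reflection_mult k_def)
  also have "\<dots> = (\<Sum>d\<in>\<Delta>. e d *\<^sub>R d)"
    unfolding b(2) by (subst a(2)) (simp add: e_def scaleR_add_left sum.distrib)
  also have "\<dots> = e \<delta> *\<^sub>R \<delta> + (\<Sum>d\<in>D. e d *\<^sub>R d)" using D by simp
  finally have eq: "(\<Sum>d\<in>D. e d *\<^sub>R d) = (k - e \<delta>) *\<^sub>R \<delta>" by (simp add: algebra_simps)
  have lex_\<delta>: "lex_positive us \<delta>" using \<delta> simple_Pos by (auto simp: Pos_iff)
  have e_nonneg: "e d \<ge> 0" if "d \<in> \<Delta>" for d using a b that by (simp add: e_def)
  show False
  proof (cases "\<exists>d \<in> D. e d \<noteq> 0")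
    case False
    \<comment> \<open>Both summands of \<open>e\<close> are non-negative, so they vanish together;
      \<gamma> is then a non-negative multiple of \<delta>, and unit length leaves only \<gamma> =
      \<delta>.\<close>
    then have "a d = 0" if "d \<in> D" for d
      using a(1)[of d] b(1)[of d] that D by (auto simp: e_def add_nonneg_eq_0_iff)
    then have \<gamma>_eq: "\<gamma> = a \<delta> *\<^sub>R \<delta>" using a(2) D by simp
    have "norm \<gamma> = 1" "norm \<delta> = 1"
      using \<gamma> \<delta> simple_Pos by (auto simp: Pos_iff root_system_iff)
    then have "a \<delta> = 1" using a(1)[OF \<delta>] unfolding \<gamma>_eq by simp
    then show False using \<gamma>_eq \<gamma> by simp
  next
    case True
    have lex: "lex_positive us ((k - e \<delta>) *\<^sub>R \<delta>)"
      unfolding eq[symmetric] using D True simple_Pos e_nonneg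
      by (intro lex_positive_sum) (auto simp: Pos_iff)
    define t where "t = k - e \<delta>"
    \<comment> \<open>A nontrivial non-negative combination of positive roots is lexicographically
      positive, so it is neither 0 nor a negative multiple of \<delta>.\<close>
    have "t > 0"
    proof (rule ccontr)
      assume "\<not> t > 0"
      then consider "t = 0" | "- t > 0" by linarith
      then show False
      proof cases
        case 1
        then show ?thesis using lex not_lex_positive_0' by (simp add: t_def)
      next
        case 2
        then show ?thesis
          using lex_positive_add[OF lex_positive_scaleR[OF lex_\<delta> 2] lex] not_lex_positive_0'
          by (simp add: t_def flip: scaleR_add_left)
      qed
    qed
    have "\<delta> = (1 / t) *\<^sub>R (\<Sum>d\<in>D. e d *\<^sub>R d)"
      unfolding eq using \<open>t > 0\<close> by (simp add: t_def)
    then have \<delta>_eq: "\<delta> = (\<Sum>d\<in>D. (e d / t) *\<^sub>R d)" by (simp add: scaleR_sum_right)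
    \<comment> \<open>Substituting the expression for \<delta> removes it from every combination,
      against the minimality of \<Delta>.\<close>
    have "nonneg_generates D Pos"
      unfolding nonneg_generates_def
    proof
      fix \<alpha> assume "\<alpha> \<in> Pos"
      then obtain f where f: "\<And>d. d \<in> \<Delta> \<Longrightarrow> f d \<ge> 0" "\<alpha> = (\<Sum>d\<in>\<Delta>. f d *\<^sub>R d)"
        using Pos_nonneg_combination by metis
      have "\<alpha> = f \<delta> *\<^sub>R \<delta> + (\<Sum>d\<in>D. f d *\<^sub>R d)" using f(2) D by simp
      also have "f \<delta> *\<^sub>R \<delta> = (\<Sum>d\<in>D. (f \<delta> * (e d / t)) *\<^sub>R d)"
        by (subst \<delta>_eq) (simp add: scaleR_sum_right)
      finally have "\<alpha> = (\<Sum>d\<in>D. (f \<delta> * (e d / t) + f d) *\<^sub>R d)"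
        by (simp add: scaleR_add_left sum.distrib)
      moreover have "f \<delta> * (e d / t) + f d \<ge> 0" if "d \<in> D" for d
        using f(1)[of d] f(1)[OF \<delta>] e_nonneg[of d] that D \<open>t > 0\<close> by simp
      ultimately show "\<exists>c. (\<forall>\<delta>\<in>D. 0 \<le> c \<delta>) \<and> \<alpha> = (\<Sum>\<delta>\<in>D. c \<delta> *\<^sub>R \<delta>)"
        by (intro exI[of _ "\<lambda>d. f \<delta> * (e d / t) + f d"]) simp
    qed
    then show False using simple_system D by (auto simp: simple_system_def)
  qed
qed

text \<open>The reflection in \<delta> permutes the other positive roots and reverses their inner
  products with \<delta>, so these cancel and only \<open>\<delta> \<bullet> \<delta>\<close>
  remains. The vector \<open>\<Sum>Pos\<close> is the analogue for unit roots of the sum of positive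
  roots in Lie theory and serves as a height function.\<close>

lemma simple_inner_sum_Pos:
  assumes \<delta>: "\<delta> \<in> \<Delta>"
  shows "\<delta> \<bullet> \<Sum>Pos = 1"
proof -
  let ?s = "reflection \<delta>" and ?P = "Pos - {\<delta>}"
  have \<delta>1: "\<delta> \<in> Pos" "norm \<delta> = 1"
    using \<delta> simple_Pos by (auto simp: Pos_iff root_system_iff)
  have "?s *v \<gamma> \<in> ?P" if "\<gamma> \<in> ?P" for \<gamma>
  proof -
    have "?s *v \<gamma> \<noteq> \<delta>"
    proof
      assume "?s *v \<gamma> = \<delta>"
      then have "\<gamma> = - \<delta>" by (metis reflection_involution reflection_self)
      then show False using that \<delta>1 not_both_Pos by auto
    qed
    then show ?thesis using that simple_reflection_permutes[OF \<delta>] by auto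
  qed
  then have "(\<Sum>\<gamma>\<in>?P. \<delta> \<bullet> (?s *v \<gamma>)) = (\<Sum>\<gamma>\<in>?P. \<delta> \<bullet> \<gamma>)"
    by (intro sum.reindex_bij_witness[where i = "(*v) ?s" and j = "(*v) ?s"])
      (auto simp: reflection_involution)
  moreover have "\<delta> \<bullet> (?s *v \<gamma>) = - (\<delta> \<bullet> \<gamma>)" for \<gamma>
    using inner_reflection[of \<delta> \<delta> \<gamma>] by (simp add: reflection_self)
  ultimately have "(\<Sum>\<gamma>\<in>?P. \<delta> \<bullet> \<gamma>) = 0" by (simp add: sum_negf)
  then have "\<delta> \<bullet> \<Sum>Pos = \<delta> \<bullet> \<delta>"
    using \<delta>1 finite_Pos by (simp add: inner_add_right inner_sum_right sum.remove[of Pos \<delta>])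
  then show ?thesis using \<delta>1 by (simp add: dot_square_norm)
qed

section \<open>Generation by simple reflections\<close>

abbreviation W :: "(real^'n^'n) set" where "W \<equiv> generate GL (simple_reflections \<Delta>)"

text \<open>In a counterexample of minimal height \<open>\<beta> \<bullet> \<Sum>Pos\<close>,
  reflecting \<beta> in a simple root at an acute angle to it gives a lower positive root, and the
  two reflections are conjugate by a simple one.\<close>

lemma Pos_reflection_in_W:
  assumes "\<alpha> \<in> Pos"
  shows "reflection \<alpha> \<in> W"
proof (rule ccontr)
  assume "reflection \<alpha> \<notin> W"
  define B where "B = {\<beta> \<in> Pos. reflection \<beta> \<notin> W}"
  have "finite B" "B \<noteq> {}"
    using finite_Pos assms \<open>reflection \<alpha> \<notin> W\<close> by (auto simp: B_def)
  then obtain \<beta> where \<beta>: "\<beta> \<in> B" "\<And>\<gamma>. \<gamma> \<in> B \<Longrightarrow> \<beta> \<bullet> \<Sum>Pos \<le> \<gamma> \<bullet> \<Sum>Pos"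
    using ex_min_if_finite[of "(\<lambda>\<gamma>. \<gamma> \<bullet> \<Sum>Pos) ` B"] by (force simp: not_less)
  have \<beta>_Pos: "\<beta> \<in> Pos" and \<beta>_W: "reflection \<beta> \<notin> W" using \<beta> by (auto simp: B_def)
  obtain c where c: "\<And>d. d \<in> \<Delta> \<Longrightarrow> c d \<ge> 0" "\<beta> = (\<Sum>d\<in>\<Delta>. c d *\<^sub>R d)"
    using Pos_nonneg_combination[OF \<beta>_Pos] by metis
  \<comment> \<open>Otherwise the expansion of \<beta> in simple roots would give
    \<open>\<beta> \<bullet> \<beta> \<le> 0\<close>.\<close>
  have "\<exists>d \<in> \<Delta>. \<beta> \<bullet> d > 0"
  proof (rule ccontr)
    assume "\<not> (\<exists>d \<in> \<Delta>. \<beta> \<bullet> d > 0)"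
    then have "(\<Sum>d\<in>\<Delta>. c d * (\<beta> \<bullet> d)) \<le> 0"
      using c(1) by (intro sum_nonpos) (auto simp: not_less mult_nonneg_nonpos)
    moreover have "(\<Sum>d\<in>\<Delta>. c d * (\<beta> \<bullet> d)) = \<beta> \<bullet> (\<Sum>d\<in>\<Delta>. c d *\<^sub>R d)"
      by (simp add: inner_sum_right)
    ultimately show False
      using \<beta>_Pos unfolding c(2)[symmetric] by (simp add: Pos_iff root_system_iff dot_square_norm)
  qed
  then obtain d where d: "d \<in> \<Delta>" "\<beta> \<bullet> d > 0" by blast
  have d_W: "reflection d \<in> W"
    using d by (intro generate.incl) (auto simp: simple_reflections_def)
  then have "\<beta> \<noteq> d" using \<beta>_W by auto
  define \<gamma> where "\<gamma> = reflection d *v \<beta>"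
  have \<gamma>_Pos: "\<gamma> \<in> Pos"
    unfolding \<gamma>_def by (rule simple_reflection_permutes) fact+
  have "d \<noteq> 0" using d by auto
  then have "\<gamma> \<bullet> \<Sum>Pos < \<beta> \<bullet> \<Sum>Pos"
    using d by (simp add: \<gamma>_def reflection_mult inner_diff_left simple_inner_sum_Pos)
  then have "\<gamma> \<notin> B" using \<beta>(2)[of \<gamma>] by linarith
  then have "reflection \<gamma> \<in> W" using \<gamma>_Pos by (simp add: B_def)
  then have "reflection d ** reflection \<gamma> ** reflection d \<in> W"
    using d_W generate.eng[of _ GL "simple_reflections \<Delta>"] by simp
  moreover have "reflection \<beta> = reflection d ** reflection \<gamma> ** reflection d"
  proof -
    have "reflection d \<in> R" using d simple_Pos by (intro reflection_in_R Pos_root) auto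
    from reflection_conj_R[OF this, of \<gamma>] show ?thesis
      by (simp add: \<gamma>_def reflection_involution transpose_reflection)
  qed
  ultimately show False using \<beta>_W by simp
qed

text \<open>The normal of a generating reflection has arbitrary length and sign; scaling it to norm
  1 and possibly negating it yields a positive root with the same reflection.\<close>

lemma R_subset_W: "R \<subseteq> W"
proof
  fix A assume "A \<in> R"
  obtain T where T: "\<forall>t \<in> T. is_reflection t" "R = generate GL T"
    using finite_reflection_group by (auto simp: finite_reflection_group_def)
  have refl_W: "t \<in> W \<and> inv\<^bsub>GL\<^esub> t = t" if t: "t \<in> T" for t
  proof -
    obtain \<alpha> where \<alpha>: "\<alpha> \<noteq> 0" "t = reflection \<alpha>" using T t by (auto simp: is_reflection_def)
    define \<beta> where "\<beta> = (1 / norm \<alpha>) *\<^sub>R \<alpha>"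
    have t_eq: "t = reflection \<beta>"
      unfolding \<beta>_def \<alpha> using \<alpha> by (intro reflection_scaleR[symmetric]) simp
    moreover have "t \<in> R" unfolding T using t by (rule generate.incl)
    ultimately have "\<beta> \<in> root_system R" using \<alpha> by (simp add: root_system_iff \<beta>_def)
    then have "\<beta> \<in> Pos \<or> - \<beta> \<in> Pos" by (rule Pos_cases)
    then have "reflection \<beta> \<in> W" using Pos_reflection_in_W reflection_minus by metis
    then show ?thesis using t_eq by (simp add: inv_reflection)
  qed
  have "A \<in> generate GL T" using \<open>A \<in> R\<close> T by simp
  then show "A \<in> W"
  proof (induction rule: generate.induct)
    case (eng h1 h2)
    then show ?case using generate.eng[of h1 GL _ h2] by simp
  qed (use refl_W generate.one[of GL "simple_reflections \<Delta>"] in auto)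
qed

section \<open>Words, exchange and length\<close>

definition word :: "(real^'n) list \<Rightarrow> real^'n^'n" where
  "word ds = foldr (\<lambda>d A. reflection d ** A) ds (mat 1)"

lemma word_simps [simp]: "word [] = mat 1" "word (d # ds) = reflection d ** word ds"
  by (simp_all add: word_def)

lemma word_append: "word (ds @ es) = word ds ** word es"
  by (induction ds) (simp_all add: matrix_mul_assoc)

lemma ex_word:
  assumes "A \<in> R"
  shows "\<exists>ds. set ds \<subseteq> \<Delta> \<and> word ds = A"
proof -
  have "A \<in> W" using assms R_subset_W by blast
  then show ?thesis
  proof (induction rule: generate.induct)
    case one
    then show ?case by (intro exI[of _ "[]"]) simp
  next
    case (incl h)
    then obtain d where "d \<in> \<Delta>" "h = reflection d" by (auto simp: simple_reflections_def)
    then show ?case by (intro exI[of _ "[d]"]) simp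
  next
    case (inv h)
    then obtain d where "d \<in> \<Delta>" "h = reflection d" by (auto simp: simple_reflections_def)
    then show ?case by (intro exI[of _ "[d]"]) (simp add: inv_reflection)
  next
    case (eng h1 h2)
    then obtain ds es where "set ds \<subseteq> \<Delta>" "word ds = h1" "set es \<subseteq> \<Delta>" "word es = h2" by blast
    then show ?case by (intro exI[of _ "ds @ es"]) (simp add: word_append)
  qed
qed

lemma strong_exchange:
  assumes "set ds \<subseteq> \<Delta>" "\<gamma> \<in> Pos" "transpose (word ds) *v \<gamma> \<notin> Pos"
  shows "\<exists>es. set es \<subseteq> \<Delta> \<and> length es < length ds \<and> reflection \<gamma> ** word ds = word es"
  using assms
proof (induction ds arbitrary: \<gamma>)
  case Nil
  then show ?case by (simp add: transpose_mat)
next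
  case (Cons d ds)
  show ?case
  proof (cases "\<gamma> = d")
    case True
    then show ?thesis
      using Cons.prems by (intro exI[of _ ds]) (simp add: matrix_mul_assoc reflection_square)
  next
    case False
    let ?\<gamma> = "reflection d *v \<gamma>"
    have d: "d \<in> \<Delta>" "reflection d \<in> R"
      using Cons.prems simple_Pos by (auto intro!: reflection_in_R Pos_root)
    have "?\<gamma> \<in> Pos" using d Cons.prems False by (intro simple_reflection_permutes) auto
    moreover have "transpose (word ds) *v ?\<gamma> \<notin> Pos"
      using Cons.prems by (simp add: matrix_transpose_mul transpose_reflection matrix_vector_mul_assoc)
    ultimately obtain es where es: "set es \<subseteq> \<Delta>" "length es < length ds"
        "reflection ?\<gamma> ** word ds = word es"
      using Cons.IH[of ?\<gamma>] Cons.prems by auto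
    have "reflection \<gamma> ** word (d # ds) = reflection (reflection d *v ?\<gamma>) ** reflection d ** word ds"
      by (simp add: reflection_involution matrix_mul_assoc)
    also have "\<dots> = reflection d ** (reflection ?\<gamma> ** word ds)"
      using reflection_conj[OF orthogonal_matrix_reflection, of d ?\<gamma>] by (simp add: matrix_mul_assoc)
    also have "\<dots> = word (d # es)" using es by simp
    finally show ?thesis using es d by (intro exI[of _ "d # es"]) auto
  qed
qed

definition word_length :: "real^'n^'n \<Rightarrow> nat" where
  "word_length A = (LEAST n. \<exists>ds. set ds \<subseteq> \<Delta> \<and> length ds = n \<and> word ds = A)"

lemma word_length_le: "set ds \<subseteq> \<Delta> \<Longrightarrow> word_length (word ds) \<le> length ds"
  unfolding word_length_def by (rule Least_le) blast

lemma ex_reduced_word: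
  assumes "A \<in> R"
  shows "\<exists>ds. set ds \<subseteq> \<Delta> \<and> length ds = word_length A \<and> word ds = A"
  unfolding word_length_def using ex_word[OF assms] by (rule_tac LeastI_ex) blast

text \<open>The transpose is the inverse, so the hypothesis says that the mirror of \<gamma>
  separates the chambers of the identity and of \<open>A\<close>; reflecting then brings
  \<open>A\<close> closer to the identity.\<close>

lemma word_length_reflection_less:
  assumes "A \<in> R" "\<gamma> \<in> Pos" "transpose A *v \<gamma> \<notin> Pos"
  shows "word_length (reflection \<gamma> ** A) < word_length A"
proof -
  obtain ds where ds: "set ds \<subseteq> \<Delta>" "length ds = word_length A" "word ds = A"
    using ex_reduced_word[OF assms(1)] by blast
  then obtain es where "set es \<subseteq> \<Delta>" "length es < length ds" "reflection \<gamma> ** A = word es"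
    using strong_exchange[of ds \<gamma>] assms by auto
  then show ?thesis using word_length_le[of es] ds by simp
qed

text \<open>The first letter \<open>d\<close> of a reduced word is a descent: otherwise \<gamma> =
  \<open>d\<close> would satisfy the length criterion for \<open>reflection d ** A\<close>, making
  \<open>A\<close> shorter than a word that has one letter fewer.\<close>

lemma ex_simple_descent:
  assumes "A \<in> R" "A \<noteq> mat 1"
  shows "\<exists>\<delta> \<in> \<Delta>. transpose A *v \<delta> \<notin> Pos"
proof -
  obtain ds where ds: "set ds \<subseteq> \<Delta>" "length ds = word_length A" "word ds = A"
    using ex_reduced_word[OF assms(1)] by blast
  with assms(2) obtain d es where ds_eq: "ds = d # es" by (cases ds) auto
  then have d: "d \<in> \<Delta>" "d \<in> Pos" "reflection d \<in> R"
    using ds simple_Pos by (auto intro!: reflection_in_R Pos_root)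
  have es: "reflection d ** A = word es"
    using ds ds_eq by (auto simp: matrix_mul_assoc reflection_square)
  show ?thesis
  proof (rule ccontr)
    assume "\<not> ?thesis"
    then have "transpose A *v d \<in> Pos" using d by blast
    moreover have "transpose (reflection d ** A) *v d = - (transpose A *v d)"
      by (simp add: matrix_transpose_mul transpose_reflection reflection_self
          matrix_vector_mult_minus flip: matrix_vector_mul_assoc)
    ultimately have "transpose (reflection d ** A) *v d \<notin> Pos"
      using not_both_Pos by metis
    then have "word_length (reflection d ** (reflection d ** A)) < word_length (reflection d ** A)"
      using d assms by (intro word_length_reflection_less mult_in_R)
    moreover have "reflection d ** (reflection d ** A) = A"
      by (simp add: matrix_mul_assoc reflection_square)
    ultimately have "word_length A < word_length (word es)" by (simp only: es)
    also have "\<dots> \<le> length es" using ds ds_eq by (intro word_length_le) auto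
    finally show False using ds ds_eq by simp
  qed
qed

text \<open>A simple reflection of the parabolic subgroup can make only its own root negative, and
  that root is excluded by the hypothesis on \<gamma>. This is what makes the side of a coset
  independent of its representative.\<close>

lemma parabolic_preserves_Pos:
  assumes T: "T \<subseteq> simple_reflections \<Delta>" and A: "A \<in> generate GL T"
    and \<gamma>: "\<gamma> \<in> Pos" "reflection \<gamma> \<notin> generate GL T"
  shows "A *v \<gamma> \<in> Pos"
  using A \<gamma>
proof (induction arbitrary: \<gamma> rule: generate.induct)
  case (incl h)
  then obtain d where "d \<in> \<Delta>" "h = reflection d" using T by (auto simp: simple_reflections_def)
  moreover have "\<gamma> \<noteq> d" using incl calculation generate.incl by metis
  ultimately show ?case using incl by (simp add: simple_reflection_permutes)
next
  case (inv h)
  then obtain d where "d \<in> \<Delta>" "h = reflection d" using T by (auto simp: simple_reflections_def)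
  moreover have "\<gamma> \<noteq> d" using inv calculation generate.incl by metis
  ultimately show ?case using inv by (simp add: simple_reflection_permutes inv_reflection)
next
  case (eng h1 h2)
  have T_R: "T \<subseteq> R"
    using T simple_Pos by (auto simp: simple_reflections_def intro!: reflection_in_R Pos_root)
  then have T_GL: "T \<subseteq> carrier GL" using subgroup.subset[OF subgroup_R] by blast
  have sub: "subgroup (generate GL T) GL"
    using T_GL by (rule group.generate_is_subgroup[OF group_GL])
  have "h2 \<in> R" using eng T_R group.generate_subgroup_incl[OF group_GL _ subgroup_R] by blast
  \<comment> \<open>The reflection is conjugate to that of \<gamma> by \<open>h2\<close>, a member
    of the subgroup, so the hypothesis on \<gamma> carries over to the next factor.\<close>
  have "reflection (h2 *v \<gamma>) \<notin> generate GL T"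
  proof
    assume "reflection (h2 *v \<gamma>) \<in> generate GL T"
    then have "transpose h2 ** (h2 ** reflection \<gamma> ** transpose h2) ** h2 \<in> generate GL T"
      using eng \<open>h2 \<in> R\<close> subgroup.m_closed[OF sub] subgroup.m_inv_closed[OF sub, of h2]
      by (simp add: reflection_conj_R inv_eq_transpose)
    moreover have "transpose h2 ** (h2 ** reflection \<gamma> ** transpose h2) ** h2
        = (transpose h2 ** h2) ** reflection \<gamma> ** (transpose h2 ** h2)"
      by (simp add: matrix_mul_assoc)
    ultimately show False using eng \<open>h2 \<in> R\<close> by (simp add: transpose_mult_R)
  qed
  then show ?case using eng by (simp flip: matrix_vector_mul_assoc)
qed simp

end

section \<open>Folding left-reflection bigraphs\<close>

definition act :: "real^'n^'n \<Rightarrow> 'n refl_vertex \<Rightarrow> 'n refl_vertex" where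
  "act A = map_sum (\<lambda>X. A <#\<^bsub>GL\<^esub> X) (\<lambda>(X, i). (A <#\<^bsub>GL\<^esub> X, i))"

locale reflection_bigraph = reflection_group R us \<Delta>
  for R :: "(real^'n^'n) set" and us \<Delta> +
  fixes S :: "nat \<Rightarrow> (real^'n^'n) set" and k :: nat
  assumes S_subset: "\<And>i. i \<le> k \<Longrightarrow> S i \<subseteq> simple_reflections \<Delta>"
begin

section \<open>Cosets as vertices\<close>

abbreviation H :: "nat \<Rightarrow> (real^'n^'n) set" where "H \<equiv> parabolic S"

abbreviation \<G> :: "'n refl_vertex bigraph" where "\<G> \<equiv> left_reflection_bigraph R S k"

text \<open>Index 0 stands for the left side, so that left and right vertices are covered by the
  same arguments about a coset of \<open>H i\<close> with \<open>i \<le> k\<close>.\<close>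

definition vertex :: "real^'n^'n \<Rightarrow> nat \<Rightarrow> 'n refl_vertex" where
  "vertex A i = (if i = 0 then Inl (A <#\<^bsub>GL\<^esub> H 0) else Inr (A <#\<^bsub>GL\<^esub> H i, i))"

lemma left_verts_eq: "left_verts \<G> = {vertex A 0 | A. A \<in> R}"
  by (simp add: left_reflection_bigraph_def vertex_def)

lemma vertex_simps:
  "vertex A 0 = Inl (A <#\<^bsub>GL\<^esub> H 0)" "1 \<le> i \<Longrightarrow> vertex A i = Inr (A <#\<^bsub>GL\<^esub> H i, i)"
  by (simp_all add: vertex_def)

lemma right_verts_eq: "right_verts \<G> = {vertex A i | A i. A \<in> R \<and> 1 \<le> i \<and> i \<le> k}"
  unfolding left_reflection_bigraph_def bigraph.simps
  by (intro Collect_cong ex_cong1) (auto simp: vertex_simps)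

lemma edges_eq: "edges \<G> = {(vertex A 0, vertex A i) | A i. A \<in> R \<and> 1 \<le> i \<and> i \<le> k}"
  unfolding left_reflection_bigraph_def bigraph.simps
  by (intro Collect_cong ex_cong1) (auto simp: vertex_simps)

lemma vertsE:
  assumes "v \<in> verts \<G>"
  obtains A i where "A \<in> R" "i \<le> k" "v = vertex A i"
  using assms unfolding verts_def left_verts_eq right_verts_eq by auto

lemma vertex_in_verts: "A \<in> R \<Longrightarrow> i \<le> k \<Longrightarrow> vertex A i \<in> verts \<G>"
  by (cases "i = 0") (auto simp: verts_def left_verts_eq right_verts_eq)

lemma edgesE:
  assumes "(v, w) \<in> edges \<G>"
  obtains A i where "A \<in> R" "1 \<le> i" "i \<le> k" "v = vertex A 0" "w = vertex A i"
  using assms unfolding edges_eq by auto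

lemma parabolic_subset_R: "i \<le> k \<Longrightarrow> H i \<subseteq> R"
  unfolding parabolic_def
  using S_subset[of i] simple_Pos
  by (intro group.generate_subgroup_incl[OF group_GL _ subgroup_R])
    (auto simp: simple_reflections_def intro!: reflection_in_R Pos_root)

lemma subgroup_parabolic: "i \<le> k \<Longrightarrow> subgroup (H i) GL"
  unfolding parabolic_def
  using S_subset[of i] simple_Pos subgroup.subset[OF subgroup_R]
  by (intro group.generate_is_subgroup[OF group_GL])
    (auto simp: simple_reflections_def intro!: subsetD[OF subgroup.subset[OF subgroup_R]] reflection_in_R Pos_root)

lemma parabolic_closed:
  assumes "i \<le> k"
  shows "A \<in> H i \<Longrightarrow> B \<in> H i \<Longrightarrow> A ** B \<in> H i" and "A \<in> H i \<Longrightarrow> transpose A \<in> H i"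
  using subgroup.m_closed[OF subgroup_parabolic[OF assms]]
    subgroup.m_inv_closed[OF subgroup_parabolic[OF assms], of A]
    parabolic_subset_R[OF assms] inv_eq_transpose[of A]
  by auto

lemma act_vertex:
  assumes "A \<in> R" "B \<in> R" "i \<le> k"
  shows "act A (vertex B i) = vertex (A ** B) i"
proof -
  have "A <#\<^bsub>GL\<^esub> (B <#\<^bsub>GL\<^esub> H j) = (A ** B) <#\<^bsub>GL\<^esub> H j" if "j \<le> k" for j
    using group.lcos_m_assoc[OF group_GL, of "H j" A B] assms
      subgroup.subset[OF subgroup_R] subgroup.subset[OF subgroup_parabolic[OF that]]
    by auto
  then show ?thesis using assms by (simp add: act_def vertex_def)
qed

lemma l_coset_parabolic_eq_iff:
  assumes "A \<in> R" "B \<in> R" "i \<le> k"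
  shows "A <#\<^bsub>GL\<^esub> H i = B <#\<^bsub>GL\<^esub> H i \<longleftrightarrow> transpose A ** B \<in> H i"
proof
  interpret H: subgroup "H i" GL using subgroup_parabolic assms by blast
  have one: "mat 1 \<in> H i" using H.one_closed by simp
  assume eq: "A <#\<^bsub>GL\<^esub> H i = B <#\<^bsub>GL\<^esub> H i"
  have "B \<in> B <#\<^bsub>GL\<^esub> H i" using one by (force simp: l_coset_def)
  then obtain h where "h \<in> H i" "B = A ** h" unfolding eq[symmetric] by (auto simp: l_coset_def)
  then show "transpose A ** B \<in> H i" using assms by (simp add: matrix_mul_assoc transpose_mult_R)
next
  assume h: "transpose A ** B \<in> H i"
  have B: "B = A ** (transpose A ** B)" using assms by (simp add: matrix_mul_assoc transpose_mult_R)
  have A: "A = B ** transpose (transpose A ** B)"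
    using assms by (simp add: matrix_transpose_mul matrix_mul_assoc transpose_mult_R)
  show "A <#\<^bsub>GL\<^esub> H i = B <#\<^bsub>GL\<^esub> H i"
  proof (intro equalityI subsetI)
    fix X assume "X \<in> A <#\<^bsub>GL\<^esub> H i"
    then obtain g where g: "g \<in> H i" "X = A ** g" by (auto simp: l_coset_def)
    have "X = B ** (transpose (transpose A ** B) ** g)"
      unfolding g(2) matrix_mul_assoc using A by simp
    then show "X \<in> B <#\<^bsub>GL\<^esub> H i"
      using g h parabolic_closed[OF assms(3)] by (force simp: l_coset_def)
  next
    fix X assume "X \<in> B <#\<^bsub>GL\<^esub> H i"
    then obtain g where g: "g \<in> H i" "X = B ** g" by (auto simp: l_coset_def)
    have "X = A ** ((transpose A ** B) ** g)"
      unfolding g(2) matrix_mul_assoc using B by (simp add: matrix_mul_assoc)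
    then show "X \<in> A <#\<^bsub>GL\<^esub> H i"
      using g h parabolic_closed[OF assms(3)] by (force simp: l_coset_def)
  qed
qed

lemma vertex_eq_iff:
  assumes "A \<in> R" "B \<in> R" "i \<le> k" "j \<le> k"
  shows "vertex A i = vertex B j \<longleftrightarrow> i = j \<and> transpose A ** B \<in> H i"
  using assms l_coset_parabolic_eq_iff[of A B i] by (auto simp: vertex_def)

lemma natural_coloring_vertex: "1 \<le> i \<Longrightarrow> natural_coloring (v, vertex A i) = i"
  by (simp add: natural_coloring_def vertex_def)

lemma act_edge:
  assumes "A \<in> R" "(v, w) \<in> edges \<G>"
  shows "(act A v, act A w) \<in> edges \<G>"
    and "natural_coloring (act A v, act A w) = natural_coloring (v, w)"
proof -
  obtain B i where B: "B \<in> R" "1 \<le> i" "i \<le> k" "v = vertex B 0" "w = vertex B i"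
    using assms(2) by (rule edgesE)
  then show "natural_coloring (act A v, act A w) = natural_coloring (v, w)"
    using assms(1) by (simp add: act_vertex natural_coloring_vertex)
  show "(act A v, act A w) \<in> edges \<G>"
    using B assms(1) unfolding edges_eq by (auto simp: act_vertex intro: mult_in_R)
qed

lemma act_left: "A \<in> R \<Longrightarrow> v \<in> left_verts \<G> \<Longrightarrow> act A v \<in> left_verts \<G>"
  unfolding left_verts_eq by (auto simp: act_vertex intro: mult_in_R)

lemma act_right: "A \<in> R \<Longrightarrow> v \<in> right_verts \<G> \<Longrightarrow> act A v \<in> right_verts \<G>"
  unfolding right_verts_eq by (auto simp: act_vertex) (blast intro: mult_in_R)

lemma act_transpose_act:
  assumes "A \<in> R" "v \<in> verts \<G>"
  shows "act (transpose A) (act A v) = v" "act A (act (transpose A) v) = v"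
proof -
  obtain B i where "B \<in> R" "i \<le> k" "v = vertex B i" using assms(2) by (rule vertsE)
  then show "act (transpose A) (act A v) = v" "act A (act (transpose A) v) = v"
    using assms(1) by (simp_all add: act_vertex mult_in_R transpose_in_R matrix_mul_assoc transpose_mult_R)
qed

section \<open>The group action by automorphisms\<close>

lemma colored_automorphism_act:
  assumes "A \<in> R"
  shows "colored_automorphism \<G> natural_coloring (act A)"
proof -
  have T: "transpose A \<in> R" using assms by (rule transpose_in_R)
  have maps: "act B ` verts \<G> \<subseteq> verts \<G>" if "B \<in> R" for B
    using act_left[OF that] act_right[OF that] by (auto simp: verts_def)
  have bij: "bij_betw (act A) (verts \<G>) (verts \<G>)"
    by (rule bij_betw_byWitness[where f' = "act (transpose A)"])
      (use assms T maps in \<open>auto simp: act_transpose_act\<close>)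
  have inv: "v \<in> act A ` X" if "v \<in> X" "act (transpose A) v \<in> X" "X \<subseteq> verts \<G>" for v X
    using that act_transpose_act(2)[OF assms, of v] by (metis image_eqI subsetD)
  have left: "act A ` left_verts \<G> = left_verts \<G>"
    using act_left assms T by (auto intro!: inv simp: verts_def)
  have right: "act A ` right_verts \<G> = right_verts \<G>"
    using act_right assms T by (auto intro!: inv simp: verts_def)
  have edge: "(act A v, act A w) \<in> edges \<G> \<longleftrightarrow> (v, w) \<in> edges \<G>"
    if "v \<in> left_verts \<G>" "w \<in> right_verts \<G>" for v w
  proof
    assume "(act A v, act A w) \<in> edges \<G>"
    from act_edge(1)[OF T this] show "(v, w) \<in> edges \<G>"
      using that assms by (simp add: act_transpose_act verts_def)
  qed (rule act_edge(1)[OF assms])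
  show ?thesis
    unfolding colored_automorphism_def bigraph_automorphism_def
    using bij left right edge act_edge(2)[OF assms] by auto
qed

text \<open>An edge of color \<open>i\<close> consists of the cosets of \<open>H 0\<close> and
  \<open>H i\<close> of one element. Left multiplication by \<open>B ** transpose A\<close> carries
  \<open>A\<close> to \<open>B\<close> and hence both ends at once.\<close>

lemma color_edge_transitive: "color_edge_transitive \<G> natural_coloring"
proof -
  have "\<exists>\<sigma>. colored_automorphism \<G> natural_coloring \<sigma> \<and> \<sigma> v1 = v2 \<and> \<sigma> w1 = w2"
    if e: "(v1, w1) \<in> edges \<G>" "(v2, w2) \<in> edges \<G>"
      and eq: "natural_coloring (v1, w1) = natural_coloring (v2, w2)" for v1 w1 v2 w2
  proof -
    obtain A i where A: "A \<in> R" "1 \<le> i" "i \<le> k" "v1 = vertex A 0" "w1 = vertex A i"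
      using e(1) by (rule edgesE)
    obtain B j where B: "B \<in> R" "1 \<le> j" "j \<le> k" "v2 = vertex B 0" "w2 = vertex B j"
      using e(2) by (rule edgesE)
    have "i = j" using eq A B by (simp add: natural_coloring_vertex)
    have C: "B ** transpose A \<in> R" using A B by (intro mult_in_R transpose_in_R)
    have "B ** transpose A ** A = B" using A by (simp add: transpose_mult_R flip: matrix_mul_assoc)
    then have "act (B ** transpose A) (vertex A l) = vertex B l" if "l \<le> k" for l
      using A C that by (simp add: act_vertex)
    then show ?thesis
      using A B \<open>i = j\<close> colored_automorphism_act[OF C]
      by (intro exI[of _ "act (B ** transpose A)"]) simp
  qed
  then show ?thesis unfolding color_edge_transitive_def by blast
qed

text \<open>The cosets \<open>A H\<^sub>i\<close> lying strictly on the positive side of the hyperplane orthogonal to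
  \<open>\<beta>\<close>; the second condition says that the coset is not fixed by the reflection in \<open>\<beta>\<close>.\<close>

definition side :: "real^'n \<Rightarrow> 'n refl_vertex set" where
  "side \<beta> = {vertex A i | A i. A \<in> R \<and> i \<le> k \<and> transpose A *v \<beta> \<in> Pos \<and>
     reflection (transpose A *v \<beta>) \<notin> H i}"

text \<open>\<open>side\<close> asks for some representative, but any one can be tested: changing it
  applies an element of \<open>H i\<close> to the pulled-back root, which keeps it positive and
  conjugates its reflection within \<open>H i\<close>.\<close>

lemma vertex_in_side_iff:
  assumes "A \<in> R" "i \<le> k"
  shows "vertex A i \<in> side \<beta> \<longleftrightarrow> transpose A *v \<beta> \<in> Pos \<and> reflection (transpose A *v \<beta>) \<notin> H i"
proof
  assume "vertex A i \<in> side \<beta>"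
  then obtain B j where B: "B \<in> R" "j \<le> k" "vertex A i = vertex B j" "transpose B *v \<beta> \<in> Pos"
      "reflection (transpose B *v \<beta>) \<notin> H j"
    unfolding side_def by blast
  let ?h = "transpose A ** B" and ?\<gamma> = "transpose B *v \<beta>"
  have h: "?h \<in> H i" "j = i" using B assms by (auto simp: vertex_eq_iff)
  have h_R: "?h \<in> R" using assms B by (intro mult_in_R transpose_in_R)
  have "?h ** transpose B = transpose A"
    using B by (simp add: transpose_mult_R flip: matrix_mul_assoc)
  then have eq: "transpose A *v \<beta> = ?h *v ?\<gamma>" by (simp only: matrix_vector_mul_assoc)
  have "?h *v ?\<gamma> \<in> Pos"
    using parabolic_preserves_Pos[OF S_subset[OF assms(2)]] h B unfolding parabolic_def by blast
  moreover have "reflection (?h *v ?\<gamma>) \<notin> H i"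
  proof
    assume "reflection (?h *v ?\<gamma>) \<in> H i"
    then have "transpose ?h ** (?h ** reflection ?\<gamma> ** transpose ?h) ** ?h \<in> H i"
      using h parabolic_closed[OF assms(2)] by (simp add: reflection_conj_R[OF h_R])
    moreover have "transpose ?h ** (?h ** reflection ?\<gamma> ** transpose ?h) ** ?h
        = (transpose ?h ** ?h) ** reflection ?\<gamma> ** (transpose ?h ** ?h)"
      by (simp only: matrix_mul_assoc)
    ultimately show False using B h by (simp add: transpose_mult_R(1)[OF h_R])
  qed
  ultimately show "transpose A *v \<beta> \<in> Pos \<and> reflection (transpose A *v \<beta>) \<notin> H i"
    unfolding eq by simp
qed (use assms in \<open>auto simp: side_def\<close>)

lemma act_reflection_side:
  assumes "\<beta> \<in> root_system R"
  shows "act (reflection \<beta>) \<in> side \<beta> \<rightarrow> side (- \<beta>)"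
proof
  fix v assume "v \<in> side \<beta>"
  then obtain A i where A: "A \<in> R" "i \<le> k" "v = vertex A i" "transpose A *v \<beta> \<in> Pos"
      "reflection (transpose A *v \<beta>) \<notin> H i"
    unfolding side_def by blast
  have s: "reflection \<beta> \<in> R" using assms by (rule reflection_in_R)
  have "transpose (reflection \<beta> ** A) *v (- \<beta>) = transpose A *v \<beta>"
    by (simp add: matrix_transpose_mul transpose_reflection matrix_vector_mult_minus reflection_self
        flip: matrix_vector_mul_assoc)
  then show "act (reflection \<beta>) v \<in> side (- \<beta>)"
    using A s by (simp add: act_vertex vertex_in_side_iff mult_in_R)
qed

lemma transpose_root: "A \<in> R \<Longrightarrow> \<beta> \<in> root_system R \<Longrightarrow> transpose A *v \<beta> \<in> root_system R"
  by (intro root_mult transpose_in_R)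

text \<open>The pulled-back root or its negative is positive, so avoiding both sides forces its
  reflection into \<open>H i\<close>. That reflection is the conjugate of the one in \<beta> by
  \<open>A\<close>, which says that the coset is preserved.\<close>

lemma act_reflection_fixed:
  assumes \<beta>: "\<beta> \<in> root_system R" and A: "A \<in> R" "i \<le> k" "vertex A i \<notin> side \<beta>" "vertex A i \<notin> side (- \<beta>)"
  shows "act (reflection \<beta>) (vertex A i) = vertex A i"
proof -
  let ?\<gamma> = "transpose A *v \<beta>"
  have "?\<gamma> \<in> Pos \<or> - ?\<gamma> \<in> Pos" using transpose_root[OF A(1) \<beta>] by (rule Pos_cases)
  then have "reflection ?\<gamma> \<in> H i"
    using A vertex_in_side_iff[OF A(1,2), of \<beta>] vertex_in_side_iff[OF A(1,2), of "- \<beta>"]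
    by (auto simp: matrix_vector_mult_minus reflection_minus)
  also have "reflection ?\<gamma> = transpose A ** (reflection \<beta> ** A)"
    using reflection_conj_R[OF transpose_in_R[OF A(1)], of \<beta>] by (simp add: matrix_mul_assoc)
  finally have "vertex A i = vertex (reflection \<beta> ** A) i"
    using A reflection_in_R[OF \<beta>] by (simp add: vertex_eq_iff mult_in_R)
  moreover have "act (reflection \<beta>) (vertex A i) = vertex (reflection \<beta> ** A) i"
    using A reflection_in_R[OF \<beta>] by (simp add: act_vertex)
  ultimately show ?thesis by simp
qed

lemma is_fold_reflection:
  assumes \<beta>: "\<beta> \<in> root_system R"
  shows "is_fold (verts \<G>) (edges \<G>) natural_coloring (act (reflection \<beta>)) (side \<beta>) (side (- \<beta>))"
  unfolding is_fold_def
proof (intro conjI allI ballI impI)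
  have s: "reflection \<beta> \<in> R" using \<beta> by (rule reflection_in_R)
  show "side \<beta> \<subseteq> verts \<G>" "side (- \<beta>) \<subseteq> verts \<G>"
    by (auto simp: side_def intro: vertex_in_verts)
  show "side \<beta> \<inter> side (- \<beta>) = {}"
  proof -
    have "v \<notin> side (- \<beta>)" if "v \<in> side \<beta>" for v
    proof -
      from that obtain A i where "A \<in> R" "i \<le> k" "v = vertex A i" "transpose A *v \<beta> \<in> Pos"
        unfolding side_def by blast
      then show ?thesis
        using not_both_Pos by (simp add: vertex_in_side_iff matrix_vector_mult_minus)
    qed
    then show ?thesis by blast
  qed
  show "act (reflection \<beta>) \<in> side \<beta> \<rightarrow> side (- \<beta>)" using \<beta> by (rule act_reflection_side)
  show "act (reflection \<beta>) \<in> side (- \<beta>) \<rightarrow> side \<beta>"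
    using act_reflection_side[OF root_minus[OF \<beta>]] by (simp add: reflection_minus)
  show "act (reflection \<beta>) (act (reflection \<beta>) v) = v" if "v \<in> verts \<G>" for v
    using act_transpose_act(1)[OF s that] by (simp add: transpose_reflection)
  show "act (reflection \<beta>) v = v" if v: "v \<in> verts \<G> - side \<beta> - side (- \<beta>)" for v
  proof -
    from v have "v \<in> verts \<G>" by simp
    then obtain A i where "A \<in> R" "i \<le> k" "v = vertex A i" by (rule vertsE)
    then show ?thesis using act_reflection_fixed[OF \<beta>] v by simp
  qed
  fix v w assume e: "(v, w) \<in> edges \<G>"
  show "(act (reflection \<beta>) v, act (reflection \<beta>) w) \<in> edges \<G>"
    "natural_coloring (act (reflection \<beta>) v, act (reflection \<beta>) w) = natural_coloring (v, w)"
    using act_edge[OF s e] by simp_all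
  obtain A i where A: "A \<in> R" "i \<le> k" "v = vertex A 0" "w = vertex A i"
    using e by (rule edgesE)
  have "\<not> (transpose A *v \<beta> \<in> Pos \<and> - (transpose A *v \<beta>) \<in> Pos)"
    using not_both_Pos by blast
  then show "\<not> (v \<in> side \<beta> \<and> w \<in> side (- \<beta>))" "\<not> (v \<in> side (- \<beta>) \<and> w \<in> side \<beta>)"
    using A by (auto simp: vertex_in_side_iff matrix_vector_mult_minus)
qed

text \<open>\<beta> runs over roots of both signs, so each mirror supplies a fold in either
  direction.\<close>

definition reflection_folds where
  "reflection_folds = {(act (reflection \<beta>), side \<beta>, side (- \<beta>)) | \<beta>. \<beta> \<in> root_system R}"

text \<open>The color of the coset of \<open>A\<close> spreads along the word length measured from \<open>A\<close>: folding along the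
  wall \<open>A \<delta>\<close> with \<open>\<delta>\<close> simple gives \<open>A B\<close> the color of \<open>A s\<^sub>\<delta> B\<close> whenever \<open>s\<^sub>\<delta> B\<close> is shorter
  than \<open>B\<close>, and leaves it unchanged otherwise.\<close>

lemma percolation:
  assumes Q: "Q m" and v0: "v0 \<in> left_verts \<G>"
    and step: "\<And>m' \<sigma> P N. Q m' \<Longrightarrow> (\<sigma>, P, N) \<in> reflection_folds \<Longrightarrow> Q (fold_coloring \<sigma> N m')"
  shows "\<exists>m'. Q m' \<and> (\<forall>v \<in> left_verts \<G>. m' v = m v0)"
proof -
  obtain A where A: "A \<in> R" "v0 = vertex A 0" using v0 unfolding left_verts_eq by blast
  \<comment> \<open>\<open>U\<close> ranges over the subsets of \<open>R\<close> that are closed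
    under passing to shorter elements. Removing an element of maximal length preserves this, which
    drives the induction.\<close>
  have "\<exists>m'. Q m' \<and> (\<forall>B \<in> U. m' (vertex (A ** B) 0) = m v0)"
    if "U \<subseteq> R" "\<And>B C. B \<in> U \<Longrightarrow> C \<in> R \<Longrightarrow> word_length C < word_length B \<Longrightarrow> C \<in> U" for U
    using finite_subset[OF that(1) finite_R] that
  proof (induction U rule: finite_psubset_induct)
    case (psubset U)
    show ?case
    proof (cases "U \<subseteq> {mat 1}")
      case True
      then show ?thesis using Q A by (intro exI[of _ m]) auto
    next
      case False
      then have "U \<noteq> {}" by auto
      have "Max (word_length ` U) \<in> word_length ` U"
        using \<open>U \<noteq> {}\<close> psubset.hyps by (intro Max_in) auto
      then obtain X where X: "X \<in> U" "word_length X = Max (word_length ` U)" by auto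
      have X_max: "word_length B \<le> word_length X" if "B \<in> U" for B
        using that psubset.hyps X by simp
      \<comment> \<open>Any \<open>B\<close> other than the identity has a descent and hence
        positive length, so an element of maximal length is not the identity.\<close>
      have "X \<noteq> mat 1"
      proof
        assume "X = mat 1"
        obtain B where B: "B \<in> U" "B \<noteq> mat 1" using False by auto
        then obtain \<delta> where \<delta>: "\<delta> \<in> \<Delta>" "transpose B *v \<delta> \<notin> Pos"
          using ex_simple_descent psubset.prems by blast
        have "word_length (reflection \<delta> ** B) < word_length B"
          using \<delta> B psubset.prems simple_Pos by (intro word_length_reflection_less) auto
        moreover have "word_length (mat 1) = 0" using word_length_le[of "[]"] by simp
        ultimately show False using X_max[OF B(1)] \<open>X = mat 1\<close> by simp
      qed
      then obtain \<delta> where \<delta>: "\<delta> \<in> \<Delta>" "transpose X *v \<delta> \<notin> Pos"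
        using ex_simple_descent X psubset.prems by blast
      have \<delta>_Pos: "\<delta> \<in> Pos" and \<delta>_root: "\<delta> \<in> root_system R"
        using \<delta> simple_Pos Pos_root by auto
      define U' where "U' = U - {X}"
      have "\<exists>m'. Q m' \<and> (\<forall>B \<in> U'. m' (vertex (A ** B) 0) = m v0)"
      proof (rule psubset.IH)
        show "U' \<subset> U" using X by (auto simp: U'_def)
        show "U' \<subseteq> R" using psubset.prems by (auto simp: U'_def)
        show "C \<in> U'" if "B \<in> U'" "C \<in> R" "word_length C < word_length B" for B C
          using that psubset.prems(2)[of B C] X_max[of B] by (auto simp: U'_def)
      qed
      then obtain m' where m': "Q m'" "\<And>B. B \<in> U' \<Longrightarrow> m' (vertex (A ** B) 0) = m v0" by blast
      \<comment> \<open>The mirror of a descent of \<open>X\<close> is transported by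
        \<open>A\<close>; pulled back along \<open>A ** B\<close> it gives
        \<open>transpose B *v \<delta>\<close>, so its sign tells whether \<delta> is a descent of
        \<open>B\<close>.\<close>
      define \<beta> where "\<beta> = A *v \<delta>"
      let ?s = "reflection \<beta>"
      have \<beta>: "\<beta> \<in> root_system R" unfolding \<beta>_def using A(1) \<delta>_root by (rule root_mult)
      then have s: "?s \<in> R" by (rule reflection_in_R)
      let ?m = "fold_coloring (act ?s) (side (- \<beta>)) m'"
      have "?m (vertex (A ** B) 0) = m v0" if B: "B \<in> U" for B
      proof -
        have B_R: "B \<in> R" "A ** B \<in> R" using B psubset.prems A by (auto intro: mult_in_R)
        have root: "transpose (A ** B) *v \<beta> = transpose B *v \<delta>"
        proof -
          have "transpose (A ** B) *v \<beta> = transpose B *v ((transpose A ** A) *v \<delta>)"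
            by (simp add: matrix_transpose_mul \<beta>_def matrix_vector_mul_assoc matrix_mul_assoc)
          then show ?thesis using A by (simp add: transpose_mult_R)
        qed
        show ?thesis
        proof (cases "transpose B *v \<delta> \<in> Pos")
          case True
          \<comment> \<open>\<delta> is a descent of \<open>X\<close> but not of \<open>B\<close>,
            so \<open>B\<close> is one of the elements already treated; its coset is not
            overwritten.\<close>
          then have "B \<in> U'" using B \<delta> by (auto simp: U'_def)
          moreover have "vertex (A ** B) 0 \<notin> side (- \<beta>)"
            unfolding vertex_in_side_iff[OF B_R(2) le0] matrix_vector_mult_minus root
            using not_both_Pos[OF True] by blast
          ultimately show ?thesis using m' by (simp add: fold_coloring_def)
        next
          case False
          have less: "word_length (reflection \<delta> ** B) < word_length B"
            using B_R \<delta>_Pos False by (intro word_length_reflection_less)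
          \<comment> \<open>Being shorter than \<open>B\<close>, the product lies in
            \<open>U\<close>, and it is not \<open>X\<close>, whose length is maximal.\<close>
          then have "reflection \<delta> ** B \<in> U'"
            using psubset.prems(2)[OF B _ less] X_max[OF B] B_R reflection_in_R[OF \<delta>_root]
            by (auto simp: U'_def intro: mult_in_R)
          then have "m' (vertex (A ** (reflection \<delta> ** B)) 0) = m v0" by (rule m')
          moreover have "A ** (reflection \<delta> ** B) = ?s ** (A ** B)"
            using reflection_conj[OF orthogonal_R[OF A(1)], of \<delta>] by (simp add: \<beta>_def matrix_mul_assoc)
          ultimately have s_color: "m' (act ?s (vertex (A ** B) 0)) = m v0"
            using s B_R by (simp add: act_vertex)
          show ?thesis
          proof (cases "vertex (A ** B) 0 \<in> side (- \<beta>)")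
            case not_in_side: False
            \<comment> \<open>On neither side the coset is fixed, so it is the very coset whose
              color is already known to be correct.\<close>
            have "vertex (A ** B) 0 \<notin> side \<beta>"
              unfolding vertex_in_side_iff[OF B_R(2) le0] root using False by blast
            then have "act ?s (vertex (A ** B) 0) = vertex (A ** B) 0"
              using not_in_side B_R by (intro act_reflection_fixed[OF \<beta>]) auto
            then show ?thesis using s_color not_in_side by (simp add: fold_coloring_def)
          qed (use s_color in \<open>simp add: fold_coloring_def\<close>)
        qed
      qed
      moreover have "Q ?m"
        using m'(1) by (rule step) (use \<beta> in \<open>auto simp: reflection_folds_def\<close>)
      ultimately show ?thesis by blast
    qed
  qed
  from this[of R] obtain m' where m': "Q m'" "\<And>B. B \<in> R \<Longrightarrow> m' (vertex (A ** B) 0) = m v0"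
    by blast
  have "m' v = m v0" if v: "v \<in> left_verts \<G>" for v
  proof -
    obtain B where B: "B \<in> R" "v = vertex B 0" using v unfolding left_verts_eq by blast
    have "A ** (transpose A ** B) = B" using A by (simp add: matrix_mul_assoc transpose_mult_R)
    then show ?thesis using m'(2)[of "transpose A ** B"] A B by (simp add: mult_in_R transpose_in_R)
  qed
  with m' show ?thesis by blast
qed

lemma left_weakly_Hoelder:
  "left_weakly_Hoelder TYPE('l) TYPE('x) TYPE('y) \<G> {1..k} natural_coloring"
proof (rule left_weakly_Hoelder_percolation[where \<F> = reflection_folds])
  show "colored_bigraph \<G> {1..k} natural_coloring"
    using finite_R by (rule colored_bigraph_left_reflection_bigraph)
  show "left_verts \<G> \<noteq> {}" using one_in_R unfolding left_verts_eq by blast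
  show "is_fold (verts \<G>) (edges \<G>) natural_coloring \<sigma> P N \<and> \<sigma> \<in> left_verts \<G> \<rightarrow> left_verts \<G>"
    if "(\<sigma>, P, N) \<in> reflection_folds" for \<sigma> P N
    using that by (auto simp: reflection_folds_def is_fold_reflection intro!: act_left reflection_in_R)
qed (rule percolation)

end

lemma right_uniform_left_reflection_bigraph:
  "right_uniform (left_reflection_bigraph R S k) {1..k} natural_coloring"
  unfolding right_uniform_def
  by (intro bexI[of _ "\<lambda>w. snd (projr w)"])
    (auto simp: left_reflection_bigraph_def natural_coloring_def)

theorem theorem3p4:
  fixes R :: "(real^'n^'n) set"
    and us :: "(real^'n) list"
    and \<Delta> :: "(real^'n) set"
    and S :: "nat \<Rightarrow> (real^'n^'n) set"
    and k :: nat
    and G :: "'n refl_vertex bigraph"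
    and c :: "'n refl_vertex \<times> 'n refl_vertex \<Rightarrow> nat"
  assumes "finite_reflection_group R"
    and "ordered_basis us"
    and "simple_system R us \<Delta>"
    and "k \<ge> 1"
    and "\<And>i. i \<le> k \<Longrightarrow> S i \<subseteq> simple_reflections \<Delta>"
    and "G = left_reflection_bigraph R S k"
    and "c = natural_coloring"
  shows "right_uniform G {1..k} c \<and>
         color_edge_transitive G c \<and>
         left_weakly_Hoelder TYPE('l) TYPE('x) TYPE('y) G {1..k} c"
proof -
  interpret reflection_bigraph R us \<Delta> S k
    using assms by unfold_locales
  show ?thesis
    unfolding assms(6,7)
    using right_uniform_left_reflection_bigraph color_edge_transitive left_weakly_Hoelder by blast
qed

end
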